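(* Let $\{\mathbb{A},\mathbb{B},c\}$ be a two-person zero-sum game such that: (b1) for each $a\in\mathbb{A}$ the function $b\mapsto c(a,b)$ is upper semi-continuous on $\mathbb{B}$; (b2) there exists $a_0\in\mathbb{A}$ such that $b\mapsto c(a_0,b)$ is sup-compact on $\mathbb{B}$; and $\hat c^{\flat}(\pi^{\mathbb B})\le v^{\flat}$ for all $\pi^{\mathbb B}\in\mathbb{P}^U(\mathbb{B})$. Then the game has a value $v$. Moreover, if $\hat c^{\flat}(\pi^{\mathbb B})<v^{\flat}$ for all $\pi^{\mathbb B}\in\mathbb{P}^U(\mathbb{B})$, then $\mathbb{P}^{\flat}_{v}(\mathbb{B})\subset\mathbb{P}^S(\mathbb{B})$, the set $\mathbb{P}^{\flat}_{v}(\mathbb{B})$ is the set of solutions for Player II, and $\mathbb{P}^{\flat}_{v}(\mathbb{B})$ is a nonempty convex compact subset of $\mathbb{P}(\mathbb{B})$.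
   Context: For a metric space $S$, $\mathbb{P}(S)$ is the set of Borel probability measures on $S$ with the topology of weak convergence. A function $f:S\to\mathbb{R}\cup\{\pm\infty\}$ is sup-compact on $S$ if $\{s\in S: f(s)\ge\lambda\}$ is compact for every $\lambda\in\mathbb{R}$. A two-person zero-sum game $\{\mathbb{A},\mathbb{B},c\}$ consists of (i) a nonempty Borel subset $\mathbb{A}$ of a Polish space; (ii) a nonempty Borel subset $\mathbb{B}$ of a Polish space; (iii) a Borel measurable payoff $c:\mathbb{A}\times\mathbb{B}\to\mathbb{R}$ (paid by Player I to Player II); such that (iv) for each $b\in\mathbb{B}$ the function $a\mapsto c(a,b)$ is bounded below on $\mathbb{A}$, and (v) for each $a\in\mathbb{A}$ the function $b\mapsto c(a,b)$ is bounded above on $\mathbb{B}$. Strategies of Players I and II are elements of $\mathbb{P}(\mathbb{A})$ and $\mathbb{P}(\mathbb{B})$; a point $a$ (or $b$) is identified with the Dirac measure at it. Let $c^+=\max\{c,0\}$, $c^-=\min\{c,0\}$ (so $c^-\le 0$), $\hat c^{\oplus}(\pi^{\mathbb A},\pi^{\mathbb B})=\int_{\mathbb A}\int_{\mathbb B}c^+(a,b)\,\pi^{\mathbb B}(db)\,\pi^{\mathbb A}(da)$ and $\hat c^{\ominus}(\pi^{\mathbb A},\pi^{\mathbb B})=\int_{\mathbb A}\int_{\mathbb B}c^-(a,b)\,\pi^{\mathbb B}(db)\,\pi^{\mathbb A}(da)$. The expected payoff $\hat c(\pi^{\mathbb A},\pi^{\mathbb B})=\hat c^{\oplus}(\pi^{\mathbb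 A},\pi^{\mathbb B})+\hat c^{\ominus}(\pi^{\mathbb A},\pi^{\mathbb B})$ is well-defined if $\hat c^{\oplus}(\pi^{\mathbb A},\pi^{\mathbb B})<+\infty$ or $\hat c^{\ominus}(\pi^{\mathbb A},\pi^{\mathbb B})>-\infty$, and undefined otherwise. By (iv),(v) it is well-defined whenever one of the strategies is a Dirac measure. $\mathbb{P}^S(\mathbb{B})$ (sensible strategies) is the set of $\pi^{\mathbb B}\in\mathbb{P}(\mathbb{B})$ such that $\hat c(\pi^{\mathbb A},\pi^{\mathbb B})$ is well-defined for every $\pi^{\mathbb A}\in\mathbb{P}(\mathbb{A})$, and $\mathbb{P}^U(\mathbb{B})=\mathbb{P}(\mathbb{B})\setminus\mathbb{P}^S(\mathbb{B})$; $\mathbb{P}^S(\mathbb{A})$ is defined symmetrically. $\hat c^{\flat}(\pi^{\mathbb B})=\inf_{a\in\mathbb{A}}\hat c(a,\pi^{\mathbb B})$, $\hat c^{\sharp}(\pi^{\mathbb A})=\sup_{b\in\mathbb{B}}\hat c(\pi^{\mathbb A},b)$; $v^{\flat}=\sup_{\pi^{\mathbb B}\in\mathbb{P}^S(\mathbb{B})}\hat c^{\flat}(\pi^{\mathbb B})$, $v^{\sharp}=\inf_{\pi^{\mathbb A}\in\mathbb{P}^S(\mathbb{A})}\hat c^{\sharp}(\pi^{\mathbb A})$. The game has a value $v$ if $v^{\flat}=v^{\sharp}$, and then $v$ is this common quantity. For an extended real $\alpha$, $\mathbb{P}^{\flat}_{\alpha}(\mathbb{B})=\{\pi^{\mathbb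 B}\in\mathbb{P}(\mathbb{B}):\hat c^{\flat}(\pi^{\mathbb B})\ge\alpha\}$. A solution for Player II is a strategy $\pi^{\mathbb B}\in\mathbb{P}^S(\mathbb{B})$ with $\hat c^{\flat}(\pi^{\mathbb B})=v^{\flat}$. *)

theory Defs
  imports "HOL-Probability.Probability"
begin

section \<open>Probability measures on a subset of a topological space\<close>

abbreviation borel_on :: "'a::topological_space set \<Rightarrow> 'a measure" where
  "borel_on S \<equiv> restrict_space borel S"

definition prob_measures :: "'a::topological_space set \<Rightarrow> 'a measure set" where
  "prob_measures S = {M. prob_space M \<and> sets M = sets (borel_on S)}"

text \<open>The coarsest topology making \<open>M \<mapsto> \<integral>f dM\<close> continuous for every bounded continuous
  \<open>f\<close> on \<open>S\<close>.\<close>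

definition weak_topology :: "'a::topological_space set \<Rightarrow> 'a measure topology" where
  "weak_topology S = topology_generated_by
     {{M \<in> prob_measures S. (\<integral>x. f x \<partial>M) \<in> U} | (f :: 'a \<Rightarrow> real) U.
        continuous_on S f \<and> bounded (f ` S) \<and> open U}"

lemma topspace_weak_topology: "topspace (weak_topology S) = prob_measures S"
proof -
  have "prob_measures S \<in> {{M \<in> prob_measures S. (\<integral>x. f x \<partial>M) \<in> U} | (f :: 'a \<Rightarrow> real) U.
        continuous_on S f \<and> bounded (f ` S) \<and> open U}"
    by (rule CollectI, rule exI[of _ "\<lambda>_. 0"], rule exI[of _ UNIV])
       (auto intro: bounded_subset[of "{0::real}"])
  then show ?thesis
    unfolding weak_topology_def topology_generated_by_topspace by auto
qed

definition mixture :: "real \<Rightarrow> 'a measure \<Rightarrow> 'a measure \<Rightarrow> 'a measure" where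
  "mixture t M N = measure_of (space M) (sets M)
     (\<lambda>X. ennreal (1 - t) * emeasure M X + ennreal t * emeasure N X)"

lemma sets_mixture: "sets (mixture t M N) = sets M"
  by (simp add: mixture_def)

lemma emeasure_mixture:
  assumes "sets N = sets M" "X \<in> sets M"
  shows "emeasure (mixture t M N) X = ennreal (1 - t) * emeasure M X + ennreal t * emeasure N X"
  unfolding mixture_def
proof (rule emeasure_measure_of_sigma)
  show "sigma_algebra (space M) (sets M)" by (rule sets.sigma_algebra_axioms)
  show "positive (sets M) (\<lambda>X. ennreal (1 - t) * emeasure M X + ennreal t * emeasure N X)"
    by (simp add: positive_def)
  show "countably_additive (sets M)
    (\<lambda>X. ennreal (1 - t) * emeasure M X + ennreal t * emeasure N X)"
    unfolding countably_additive_def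
  proof (intro allI impI)
    fix F :: "nat \<Rightarrow> 'a set"
    assume F: "range F \<subseteq> sets M" "disjoint_family F"
    then have "range F \<subseteq> sets N" using assms(1) by simp
    with F show "(\<Sum>i. ennreal (1 - t) * emeasure M (F i) + ennreal t * emeasure N (F i)) =
        ennreal (1 - t) * emeasure M (\<Union>i. F i) + ennreal t * emeasure N (\<Union>i. F i)"
      by (simp add: suminf_add[symmetric] suminf_emeasure)
  qed
qed (rule assms(2))

definition convex_measures :: "'a measure set \<Rightarrow> bool" where
  "convex_measures P \<longleftrightarrow> (\<forall>M\<in>P. \<forall>N\<in>P. \<forall>t\<in>{0..1}. mixture t M N \<in> P)"


section \<open>Semicontinuity and sup-compactness\<close>

text \<open>The filter \<^term>\<open>at x within S\<close> omits \<^term>\<open>x\<close> itself; this does not affect the notion.\<close>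

definition usc_on :: "'a::topological_space set \<Rightarrow> ('a \<Rightarrow> ereal) \<Rightarrow> bool" where
  "usc_on S f \<longleftrightarrow> (\<forall>x\<in>S. Limsup (at x within S) f \<le> f x)"

definition sup_compact_on :: "'a::topological_space set \<Rightarrow> ('a \<Rightarrow> ereal) \<Rightarrow> bool" where
  "sup_compact_on S f \<longleftrightarrow> (\<forall>r::real. compact {s \<in> S. f s \<ge> ereal r})"


section \<open>Two-person zero-sum games\<close>

locale zero_sum_game =
  fixes A :: "'a::polish_space set"
    and B :: "'b::polish_space set"
    and c :: "'a \<Rightarrow> 'b \<Rightarrow> real"
  assumes A_borel: "A \<in> sets borel" and A_nonempty: "A \<noteq> {}"
    and B_borel: "B \<in> sets borel" and B_nonempty: "B \<noteq> {}"
    and c_measurable: "(\<lambda>(a, b). c a b) \<in> borel_measurable (borel_on (A \<times> B))"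
    and c_bdd_below: "\<And>b. b \<in> B \<Longrightarrow> bdd_below ((\<lambda>a. c a b) ` A)"
    and c_bdd_above: "\<And>a. a \<in> A \<Longrightarrow> bdd_above ((\<lambda>b. c a b) ` B)"

definition dirac :: "'a::topological_space set \<Rightarrow> 'a \<Rightarrow> 'a measure" where
  "dirac S x = return (borel_on S) x"

text \<open>The parts \<open>c\<^sup>+ = max c 0\<close> and \<open>c\<^sup>- = min c 0\<close> have constant sign, so their iterated integrals
  are Lebesgue integrals of nonnegative functions, up to a sign for \<open>c\<^sup>-\<close>. The action sets enter
  only as the underlying spaces of the two measures.\<close>

definition payoff_plus :: "('a \<Rightarrow> 'b \<Rightarrow> real) \<Rightarrow> 'a measure \<Rightarrow> 'b measure \<Rightarrow> ereal" where
  "payoff_plus c \<pi>A \<pi>B = enn2ereal (\<integral>\<^sup>+a. (\<integral>\<^sup>+b. ennreal (max (c a b) 0) \<partial>\<pi>B) \<partial>\<pi>A)"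

definition payoff_minus :: "('a \<Rightarrow> 'b \<Rightarrow> real) \<Rightarrow> 'a measure \<Rightarrow> 'b measure \<Rightarrow> ereal" where
  "payoff_minus c \<pi>A \<pi>B = - enn2ereal (\<integral>\<^sup>+a. (\<integral>\<^sup>+b. ennreal (- min (c a b) 0) \<partial>\<pi>B) \<partial>\<pi>A)"

definition payoff_well_defined :: "('a \<Rightarrow> 'b \<Rightarrow> real) \<Rightarrow> 'a measure \<Rightarrow> 'b measure \<Rightarrow> bool" where
  "payoff_well_defined c \<pi>A \<pi>B \<longleftrightarrow> payoff_plus c \<pi>A \<pi>B < \<infinity> \<or> payoff_minus c \<pi>A \<pi>B > - \<infinity>"

text \<open>Only meaningful under \<^const>\<open>payoff_well_defined\<close> (otherwise it is the junk value
  \<open>\<infinity> + - \<infinity> = \<infinity>\<close>).\<close>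

definition payoff :: "('a \<Rightarrow> 'b \<Rightarrow> real) \<Rightarrow> 'a measure \<Rightarrow> 'b measure \<Rightarrow> ereal" where
  "payoff c \<pi>A \<pi>B = payoff_plus c \<pi>A \<pi>B + payoff_minus c \<pi>A \<pi>B"

text \<open>In the names below, \<open>I\<close> and \<open>II\<close> refer to Player I (on \<open>A\<close>) and Player II (on \<open>B\<close>);
  \<open>flat\<close> and \<open>sharp\<close> to \<open>\<flat>\<close> and \<open>\<sharp>\<close>.\<close>

definition sensible_I ::
    "'a::topological_space set \<Rightarrow> 'b::topological_space set \<Rightarrow> ('a \<Rightarrow> 'b \<Rightarrow> real) \<Rightarrow> 'a measure set" where
  "sensible_I A B c =
     {\<pi>A \<in> prob_measures A. \<forall>\<pi>B\<in>prob_measures B. payoff_well_defined c \<pi>A \<pi>B}"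

definition sensible_II ::
    "'a::topological_space set \<Rightarrow> 'b::topological_space set \<Rightarrow> ('a \<Rightarrow> 'b \<Rightarrow> real) \<Rightarrow> 'b measure set" where
  "sensible_II A B c =
     {\<pi>B \<in> prob_measures B. \<forall>\<pi>A\<in>prob_measures A. payoff_well_defined c \<pi>A \<pi>B}"

definition unsensible_II ::
    "'a::topological_space set \<Rightarrow> 'b::topological_space set \<Rightarrow> ('a \<Rightarrow> 'b \<Rightarrow> real) \<Rightarrow> 'b measure set" where
  "unsensible_II A B c = prob_measures B - sensible_II A B c"

definition payoff_flat ::
    "'a::topological_space set \<Rightarrow> ('a \<Rightarrow> 'b \<Rightarrow> real) \<Rightarrow> 'b measure \<Rightarrow> ereal" where
  "payoff_flat A c \<pi>B = (INF a\<in>A. payoff c (dirac A a) \<pi>B)"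

definition payoff_sharp ::
    "'b::topological_space set \<Rightarrow> ('a \<Rightarrow> 'b \<Rightarrow> real) \<Rightarrow> 'a measure \<Rightarrow> ereal" where
  "payoff_sharp B c \<pi>A = (SUP b\<in>B. payoff c \<pi>A (dirac B b))"

definition v_flat ::
    "'a::topological_space set \<Rightarrow> 'b::topological_space set \<Rightarrow> ('a \<Rightarrow> 'b \<Rightarrow> real) \<Rightarrow> ereal" where
  "v_flat A B c = (SUP \<pi>B\<in>sensible_II A B c. payoff_flat A c \<pi>B)"

definition v_sharp ::
    "'a::topological_space set \<Rightarrow> 'b::topological_space set \<Rightarrow> ('a \<Rightarrow> 'b \<Rightarrow> real) \<Rightarrow> ereal" where
  "v_sharp A B c = (INF \<pi>A\<in>sensible_I A B c. payoff_sharp B c \<pi>A)"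

definition is_game_value ::
    "'a::topological_space set \<Rightarrow> 'b::topological_space set \<Rightarrow> ('a \<Rightarrow> 'b \<Rightarrow> real) \<Rightarrow> ereal \<Rightarrow> bool" where
  "is_game_value A B c v \<longleftrightarrow> v_flat A B c = v \<and> v_sharp A B c = v"

definition flat_level_set ::
    "'a::topological_space set \<Rightarrow> 'b::topological_space set \<Rightarrow> ('a \<Rightarrow> 'b \<Rightarrow> real) \<Rightarrow> ereal
      \<Rightarrow> 'b measure set" where
  "flat_level_set A B c \<alpha> = {\<pi>B \<in> prob_measures B. payoff_flat A c \<pi>B \<ge> \<alpha>}"

definition solutions_II ::
    "'a::topological_space set \<Rightarrow> 'b::topological_space set \<Rightarrow> ('a \<Rightarrow> 'b \<Rightarrow> real) \<Rightarrow> 'b measure set" where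
  "solutions_II A B c = {\<pi>B \<in> sensible_II A B c. payoff_flat A c \<pi>B = v_flat A B c}"

end

theory Submission
  imports Defs
begin

text \<open>
  The difficulty lies in producing one strategy of Player II that guarantees \<open>v\<^sup>\<sharp>\<close>; everything else is
  bookkeeping with integrals that may be infinite.

  For a pure strategy \<open>a\<close> of Player I choose a real \<open>U \<ge> 0\<close> above \<open>c a\<close>. Then the payoff against \<open>\<pi>\<close> is
  \<open>U - \<integral>(U - c a) d\<pi>\<close>, and the integrand \<open>U - c a\<close> is nonnegative and lower semicontinuous. The condition
  that the payoff is at least \<open>r\<close> thus becomes the upper bound \<open>U - r\<close> on an integral
  (\<open>payoff_dirac_I_ge_iff\<close>). Such a bound is stable under mixtures. It also amounts to the same bound for
  all bounded continuous functions between \<open>0\<close> and \<open>U - c a\<close>, so it defines a weakly closed set; and for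
  the action \<open>a\<^sub>0\<close> with sup-compact payoff this set is weakly compact (\<open>compactin_weak_nn_integral_le\<close>).

  The compactness is the hard direction of Prokhorov's theorem. A measure is viewed as the functional
  \<open>f \<mapsto> \<integral>f d\<pi>\<close>. Normalised positive linear functionals that obey the bound form a closed subset of
  a product of compact intervals, hence a compact set by Tychonoff's theorem. The bound makes them tight,
  and a tight positive functional is an integral: the supremum of its values on the functions between \<open>0\<close>
  and the indicator of an open set is a content, whose outer measure is a Borel measure by
  Caratheodory's theorem (locale \<open>tight_functional\<close>).

  Let \<open>\<alpha> < v\<^sup>\<sharp>\<close> and let finitely many actions of Player I be given. The vectors of payoffs that strategies
  of Player II yield against them form a convex set. If none of these vectors exceeded \<open>\<alpha>\<close> in all
  coordinates, a separating weight would be a mixed strategy of Player I that holds every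
  action of Player II down to \<open>\<alpha>\<close>, contrary to \<open>\<alpha> < v\<^sup>\<sharp>\<close>. So the sets of strategies with payoff at least
  \<open>\<alpha>\<close> against \<open>a\<close>, for \<open>a\<close> in \<open>A\<close> and \<open>\<alpha> < v\<^sup>\<sharp>\<close>, have the finite intersection property, and by compactness
  some \<open>\<pi>\<close> lies in all of them. The hypothesis on strategies that are not sensible gives
  \<open>v\<^sup>\<sharp> \<le> v\<^sup>\<flat>\<close>, and Fubini's theorem gives the converse inequality.
\<close>

section \<open>Bounded continuous functions and their integrals\<close>

definition bounded_continuous_on :: "'a::topological_space set \<Rightarrow> ('a \<Rightarrow> real) \<Rightarrow> bool" where
  "bounded_continuous_on S f \<longleftrightarrow> continuous_on S f \<and> bounded (f ` S)"

lemma bounded_continuous_onI: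
  assumes "continuous_on S f" "\<And>x. x \<in> S \<Longrightarrow> \<bar>f x\<bar> \<le> (M::real)"
  shows "bounded_continuous_on S f"
  using assms by (auto simp: bounded_continuous_on_def bounded_iff)

lemma bounded_continuous_onE:
  assumes "bounded_continuous_on S f"
  obtains M where "continuous_on S f" "\<And>x. x \<in> S \<Longrightarrow> \<bar>f x\<bar> \<le> M"
  using assms by (auto simp: bounded_continuous_on_def bounded_iff)

lemma bounded_continuous_on_const: "bounded_continuous_on S (\<lambda>_. r)"
  by (rule bounded_continuous_onI[of _ _ "\<bar>r\<bar>"]) auto

lemma bounded_continuous_on_add:
  assumes "bounded_continuous_on S f" "bounded_continuous_on S g"
  shows "bounded_continuous_on S (\<lambda>x. f x + g x)"
proof -
  obtain M where M: "continuous_on S f" "\<And>x. x \<in> S \<Longrightarrow> \<bar>f x\<bar> \<le> M"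
    using assms(1) by (rule bounded_continuous_onE) blast
  obtain N where N: "continuous_on S g" "\<And>x. x \<in> S \<Longrightarrow> \<bar>g x\<bar> \<le> N"
    using assms(2) by (rule bounded_continuous_onE) blast
  show ?thesis
    by (rule bounded_continuous_onI[of _ _ "M + N"])
       (use M N in \<open>auto intro!: continuous_intros order_trans[OF abs_triangle_ineq] add_mono\<close>)
qed

lemma bounded_continuous_on_scale:
  assumes "bounded_continuous_on S f"
  shows "bounded_continuous_on S (\<lambda>x. r * f x)"
proof -
  obtain M where M: "continuous_on S f" "\<And>x. x \<in> S \<Longrightarrow> \<bar>f x\<bar> \<le> M"
    using assms(1) by (rule bounded_continuous_onE) blast
  show ?thesis
    by (rule bounded_continuous_onI[of _ _ "\<bar>r\<bar> * M"])
       (use M in \<open>auto intro!: continuous_intros mult_left_mono simp: abs_mult\<close>)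
qed

lemma bounded_continuous_on_diff:
  assumes "bounded_continuous_on S f" "bounded_continuous_on S g"
  shows "bounded_continuous_on S (\<lambda>x. f x - g x)"
  using bounded_continuous_on_add[OF assms(1) bounded_continuous_on_scale[OF assms(2), of "-1"]]
  by simp

lemma bounded_continuous_on_max:
  assumes "bounded_continuous_on S f"
  shows "bounded_continuous_on S (\<lambda>x. max (f x) r)"
proof -
  obtain M where M: "continuous_on S f" "\<And>x. x \<in> S \<Longrightarrow> \<bar>f x\<bar> \<le> M"
    using assms(1) by (rule bounded_continuous_onE) blast
  show ?thesis
  proof (rule bounded_continuous_onI[of _ _ "max M \<bar>r\<bar>"])
    show "continuous_on S (\<lambda>x. max (f x) r)" using M by (intro continuous_intros)
    show "\<bar>max (f x) r\<bar> \<le> max M \<bar>r\<bar>" if "x \<in> S" for x using M(2)[OF that] by linarith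
  qed
qed

lemma bounded_continuous_on_min:
  assumes "bounded_continuous_on S f"
  shows "bounded_continuous_on S (\<lambda>x. min (f x) r)"
proof -
  obtain M where M: "continuous_on S f" "\<And>x. x \<in> S \<Longrightarrow> \<bar>f x\<bar> \<le> M"
    using assms(1) by (rule bounded_continuous_onE) blast
  show ?thesis
  proof (rule bounded_continuous_onI[of _ _ "max M \<bar>r\<bar>"])
    show "continuous_on S (\<lambda>x. min (f x) r)" using M by (intro continuous_intros)
    show "\<bar>min (f x) r\<bar> \<le> max M \<bar>r\<bar>" if "x \<in> S" for x using M(2)[OF that] by linarith
  qed
qed

lemma bounded_continuous_on_sum:
  assumes "\<And>i. i \<in> I \<Longrightarrow> bounded_continuous_on S (f i)"
  shows "bounded_continuous_on S (\<lambda>x. \<Sum>i\<in>I. f i x)"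
  using assms
proof (induction I rule: infinite_finite_induct)
  case (insert i I)
  then show ?case by (simp add: bounded_continuous_on_add)
qed (simp_all add: bounded_continuous_on_const)

lemma sets_prob_measures: "M \<in> prob_measures S \<Longrightarrow> sets M = sets (borel_on S)"
  by (simp add: prob_measures_def)

lemma space_prob_measures: "M \<in> prob_measures S \<Longrightarrow> space M = S"
  using sets_eq_imp_space_eq[OF sets_prob_measures, of M S] by (simp add: space_restrict_space)

lemma bounded_continuous_on_imp_integrable:
  assumes M: "M \<in> prob_measures S" and f: "bounded_continuous_on S f"
  shows "integrable M f"
proof -
  interpret prob_space M using M by (simp add: prob_measures_def)
  note sets = sets_prob_measures[OF M] and space = space_prob_measures[OF M]
  obtain K where K: "continuous_on S f" "\<And>x. x \<in> S \<Longrightarrow> \<bar>f x\<bar> \<le> K"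
    using f by (rule bounded_continuous_onE) blast
  have "f \<in> borel_measurable M"
    using borel_measurable_continuous_on_restrict[OF K(1)] measurable_cong_sets[OF sets refl] by blast
  then show ?thesis
    using K(2) by (intro integrable_const_bound[where B = K]) (auto simp: space)
qed

section \<open>Tight positive functionals are integrals\<close>

lemma open_eq_positivity_set:
  fixes G :: "'a::metric_space set"
  assumes "open G"
  obtains d :: "'a \<Rightarrow> real" where "continuous_on UNIV d" "\<And>x. 0 \<le> d x" "\<And>x. 0 < d x \<longleftrightarrow> x \<in> G"
proof (cases "G = UNIV")
  case True
  then show ?thesis by (intro that[of "\<lambda>_. 1"]) auto
next
  case False
  then have "- G \<noteq> {}" by auto
  moreover have "closed (- G)" using assms by auto
  ultimately have "infdist x (- G) = 0 \<longleftrightarrow> x \<in> - G" for x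
    using in_closed_iff_infdist_zero by metis
  then have "0 < infdist x (- G) \<longleftrightarrow> x \<in> G" for x
    using infdist_nonneg[of x "- G"] by (metis Compl_iff less_le)
  then show ?thesis
    by (intro that[of "\<lambda>x. infdist x (- G)"]) (auto intro!: continuous_intros infdist_nonneg)
qed

text \<open>Tightness is expressed by the bound \<open>k\<close> on the functional below \<open>g\<close>: a function with values in \<open>[0, 1]\<close>
  that vanishes on the compact set \<open>{g \<le> r}\<close> is at most \<open>g / r\<close>, so the functional is at most \<open>k / r\<close>
  on it. The functional is applied to functions on the whole type, but by positivity only their values on
  \<open>S\<close> matter.\<close>

locale tight_functional =
  fixes S :: "'a::metric_space set" and L :: "('a \<Rightarrow> real) \<Rightarrow> real" and g :: "'a \<Rightarrow> real" and k :: real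
  assumes add: "\<And>f f'. bounded_continuous_on S f \<Longrightarrow> bounded_continuous_on S f' \<Longrightarrow>
      L (\<lambda>x. f x + f' x) = L f + L f'"
    and scale: "\<And>f r. bounded_continuous_on S f \<Longrightarrow> L (\<lambda>x. r * f x) = r * L f"
    and nonneg: "\<And>f. bounded_continuous_on S f \<Longrightarrow> (\<And>x. x \<in> S \<Longrightarrow> 0 \<le> f x) \<Longrightarrow> 0 \<le> L f"
    and one: "L (\<lambda>_. 1) = 1"
    and compact_sublevel: "\<And>r. compact {x \<in> S. g x \<le> r}"
    and g_nonneg: "\<And>x. x \<in> S \<Longrightarrow> 0 \<le> g x"
    and tight: "\<And>f. bounded_continuous_on S f \<Longrightarrow> (\<And>x. x \<in> S \<Longrightarrow> 0 \<le> f x \<and> f x \<le> g x) \<Longrightarrow> L f \<le> k"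
begin

lemma diff:
  assumes "bounded_continuous_on S f" "bounded_continuous_on S f'"
  shows "L (\<lambda>x. f x - f' x) = L f - L f'"
  using add[OF assms(1) bounded_continuous_on_scale[OF assms(2), of "-1"]] scale[OF assms(2), of "-1"]
  by simp

lemma mono:
  assumes "bounded_continuous_on S f" "bounded_continuous_on S f'" "\<And>x. x \<in> S \<Longrightarrow> f x \<le> f' x"
  shows "L f \<le> L f'"
  using nonneg[OF bounded_continuous_on_diff[OF assms(2,1)]] diff[OF assms(2,1)] assms(3) by simp

lemma cong:
  assumes "bounded_continuous_on S f" "bounded_continuous_on S f'" "\<And>x. x \<in> S \<Longrightarrow> f x = f' x"
  shows "L f = L f'"
  using mono[OF assms(1,2)] mono[OF assms(2,1)] assms(3) by force

lemma const: "L (\<lambda>_. r) = r"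
  using scale[OF bounded_continuous_on_const, of r 1] one by simp

lemma sum:
  assumes "finite I" "\<And>i. i \<in> I \<Longrightarrow> bounded_continuous_on S (f i)"
  shows "L (\<lambda>x. \<Sum>i\<in>I. f i x) = (\<Sum>i\<in>I. L (f i))"
  using assms
proof (induction I rule: finite_induct)
  case empty
  then show ?case by (simp add: const)
next
  case (insert i I)
  then show ?case by (simp add: add bounded_continuous_on_sum)
qed

text \<open>Daniell's continuity condition. On the compact set \<open>{g \<le> r}\<close> the convergence is uniform by
  Dini's argument, and what lies outside contributes at most \<open>k / r\<close>.\<close>

lemma decreasing_to_zero:
  assumes f: "\<And>n. bounded_continuous_on S (f n)"
    and f01: "\<And>n x. x \<in> S \<Longrightarrow> 0 \<le> f n x \<and> f n x \<le> 1"
    and dec: "\<And>x. x \<in> S \<Longrightarrow> decseq (\<lambda>n. f n x)"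
    and lim: "\<And>x. x \<in> S \<Longrightarrow> (\<lambda>n. f n x) \<longlonglongrightarrow> 0"
    and e: "0 < e"
  shows "\<exists>n. L (f n) \<le> e"
proof -
  \<comment> \<open>Chosen so that \<open>k / r \<le> e / 2\<close>, with \<open>r > 0\<close> also when \<open>k\<close> is not positive.\<close>
  define r where "r = 2 * max k 0 / e + 1"
  have r: "0 < r" using e by (auto simp: r_def intro!: add_nonneg_pos divide_nonneg_pos)
  have "r * (e/2) = max k 0 + e/2" using e by (simp add: r_def field_simps)
  then have kr: "k \<le> r * (e/2)" using e by simp
  \<comment> \<open>Dini: the closed sets on which \<open>f n\<close> has not yet dropped below \<open>e / 2\<close> decrease to the empty set.\<close>
  define C where "C n = {x \<in> S. g x \<le> r} \<inter> {x \<in> S. e/2 \<le> f n x}" for n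
  have "\<exists>n. C n = {}"
  proof (rule ccontr)
    assume "\<nexists>n. C n = {}"
    then have ne: "C n \<noteq> {}" for n by blast
    have "compact (C n)" for n
    proof -
      have co: "continuous_on {x \<in> S. g x \<le> r} (f n)"
        using f[of n] by (auto simp: bounded_continuous_on_def elim: continuous_on_subset)
      have "closed {x \<in> {x \<in> S. g x \<le> r}. e/2 \<le> f n x}"
        by (intro continuous_on_closed_Collect_le continuous_intros co compact_imp_closed compact_sublevel)
      then have "compact ({x \<in> S. g x \<le> r} \<inter> {x \<in> {x \<in> S. g x \<le> r}. e/2 \<le> f n x})"
        by (intro compact_Int_closed compact_sublevel)
      moreover have "{x \<in> S. g x \<le> r} \<inter> {x \<in> {x \<in> S. g x \<le> r}. e/2 \<le> f n x} = C n"
        by (auto simp: C_def)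
      ultimately show ?thesis by simp
    qed
    moreover have "C n \<subseteq> C m" if "m \<le> n" for m n
      using decseqD[OF dec that] by (auto simp: C_def intro: order_trans)
    ultimately have "\<Inter> (range C) \<noteq> {}"
      using ne compact_sublevel[of r]
      by (intro compact_space_imp_nest[of "top_of_set {x \<in> S. g x \<le> r}"])
         (auto simp: compact_space_subtopology decseq_def C_def intro!: closed_subset compact_imp_closed)
    then obtain x where x: "\<And>n. x \<in> C n" by auto
    then have "x \<in> S" "\<And>n. e/2 \<le> f n x" by (auto simp: C_def)
    then have "e/2 \<le> 0" using LIMSEQ_le_const[OF lim] by blast
    with e show False by simp
  qed
  then obtain n where n: "C n = {}" by blast
  \<comment> \<open>The excess of \<open>f n\<close> over \<open>e / 2\<close> vanishes where \<open>g \<le> r\<close>, so \<open>r\<close> times it stays below \<open>g\<close>.\<close>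
  define h where "h x = max (f n x - e/2) 0" for x
  have h: "bounded_continuous_on S h"
    unfolding h_def
    by (intro bounded_continuous_on_max bounded_continuous_on_diff bounded_continuous_on_const f)
  have "L (\<lambda>x. r * h x) \<le> k"
  proof (rule tight)
    show "bounded_continuous_on S (\<lambda>x. r * h x)" by (rule bounded_continuous_on_scale[OF h])
    fix x assume x: "x \<in> S"
    show "0 \<le> r * h x \<and> r * h x \<le> g x"
    proof (cases "g x \<le> r")
      case True
      then have "f n x < e/2" using n x by (auto simp: C_def not_le)
      then show ?thesis using g_nonneg[OF x] by (simp add: h_def)
    next
      case False
      have "f n x - e/2 \<le> 1" using f01[OF x, of n] e by linarith
      then have "h x \<le> 1" "0 \<le> h x" by (auto simp: h_def)
      then have "0 \<le> r * h x" "r * h x \<le> r" using r by (auto simp: mult_left_le)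
      then show ?thesis using False by auto
    qed
  qed
  then have "r * L h \<le> r * (e/2)" using scale[OF h] kr by simp
  then have Lh: "L h \<le> e/2" using r mult_le_cancel_left_pos by blast
  have "L (f n) \<le> L (\<lambda>x. e/2 + h x)"
    by (rule mono[OF f]) (auto simp: h_def intro!: bounded_continuous_on_add[OF bounded_continuous_on_const h, unfolded h_def])
  also have "\<dots> = e/2 + L h" using add[OF bounded_continuous_on_const h] const by simp
  finally show ?thesis using Lh by (auto intro!: exI[of _ n])
qed

definition bumps :: "'a set \<Rightarrow> ('a \<Rightarrow> real) set" where
  "bumps G = {f. bounded_continuous_on S f \<and> (\<forall>x\<in>S. 0 \<le> f x \<and> f x \<le> 1) \<and> (\<forall>x\<in>S - G. f x = 0)}"

definition content :: "'a set \<Rightarrow> ennreal" where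
  "content G = (SUP f\<in>bumps G. ennreal (L f))"

definition outer :: "'a set \<Rightarrow> ennreal" where
  "outer X = (INF G\<in>{G. open G \<and> X \<subseteq> G}. content G)"

lemma content_mono: "S \<inter> G \<subseteq> H \<Longrightarrow> content G \<le> content H"
  unfolding content_def by (rule SUP_subset_mono) (auto simp: bumps_def)

lemma content_upper: "f \<in> bumps G \<Longrightarrow> ennreal (L f) \<le> content G"
  unfolding content_def by (rule SUP_upper)

lemma bumps_nonneg: "f \<in> bumps G \<Longrightarrow> 0 \<le> L f"
  by (rule nonneg) (auto simp: bumps_def)

lemma content_le_one: "content G \<le> 1"
  unfolding content_def
proof (rule SUP_least)
  fix f assume "f \<in> bumps G"
  then have "L f \<le> L (\<lambda>_. 1)" by (intro mono bounded_continuous_on_const) (auto simp: bumps_def)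
  then show "ennreal (L f) \<le> 1" by (simp add: one)
qed

lemma content_empty: "content {} = 0"
proof -
  have "ennreal (L f) \<le> 0" if "f \<in> bumps {}" for f
  proof -
    have "L f = L (\<lambda>_. 0)"
      using that by (intro cong bounded_continuous_on_const) (auto simp: bumps_def)
    then show ?thesis by (simp add: const)
  qed
  then have "content {} \<le> 0" unfolding content_def by (rule SUP_least)
  then show ?thesis by simp
qed

lemma outer_open: "open G \<Longrightarrow> outer (S \<inter> G) = content G"
  unfolding outer_def
  by (rule antisym) (auto intro!: INF_lower2[of G] INF_greatest content_mono)

text \<open>If \<open>d\<^sub>i\<close> is positive exactly on \<open>G\<^sub>i\<close>, the sums \<open>\<Sum>i<n. min 1 (n d\<^sub>i)\<close> eventually exceed any
  function below the indicator of the union. Each summand is admissible for the content of its \<open>G\<^sub>i\<close>, and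
  the excess that remains is negligible by Daniell continuity.\<close>

lemma content_countably_subadditive:
  assumes "\<And>i::nat. open (G i)"
  shows "content (\<Union>i. G i) \<le> (\<Sum>i. content (G i))"
  unfolding content_def[of "\<Union>i. G i"]
proof (rule SUP_least)
  fix f assume f: "f \<in> bumps (\<Union>i. G i)"
  then have bf: "bounded_continuous_on S f" and f01: "\<And>x. x \<in> S \<Longrightarrow> 0 \<le> f x \<and> f x \<le> 1"
    and f0: "\<And>x. x \<in> S \<Longrightarrow> x \<notin> (\<Union>i. G i) \<Longrightarrow> f x = 0" by (auto simp: bumps_def)
  have "\<exists>d::'a \<Rightarrow> real. continuous_on UNIV d \<and> (\<forall>x. 0 \<le> d x) \<and> (\<forall>x. 0 < d x \<longleftrightarrow> x \<in> G i)" for i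
    using open_eq_positivity_set[OF assms[of i]] by metis
  then obtain d :: "nat \<Rightarrow> 'a \<Rightarrow> real"
    where d: "\<And>i. continuous_on UNIV (d i)" "\<And>i x. 0 \<le> d i x" "\<And>i x. 0 < d i x \<longleftrightarrow> x \<in> G i"
    by metis
  have d': "continuous_on S (d i)" for i by (rule continuous_on_subset[OF d(1)]) auto
  define t where "t n i x = min 1 (real n * d i x)" for n i x
  define s where "s n x = (\<Sum>i<n. t n i x)" for n x
  have t: "t n i \<in> bumps (G i)" for n i
  proof -
    have "d i x = 0" if "x \<notin> G i" for x using d(2)[of i x] d(3)[of i x] that by auto
    moreover have "bounded_continuous_on S (\<lambda>x. min 1 (real n * d i x))"
      using d(2) by (intro bounded_continuous_onI[where M = 1] continuous_intros d') auto
    ultimately show ?thesis using d(2) by (auto simp: bumps_def t_def[abs_def])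
  qed
  have bt: "bounded_continuous_on S (t n i)" for n i using t by (auto simp: bumps_def)
  have bs: "bounded_continuous_on S (s n)" for n
    unfolding s_def by (rule bounded_continuous_on_sum[OF bt])
  have t0: "0 \<le> t n i x" for n i x using d(2) by (auto simp: t_def)
  have tm: "t n i x \<le> t m i x" if "n \<le> m" for n m i x
    unfolding t_def using that d(2)[of i x] by (intro min.mono mult_right_mono) auto
  have s0: "0 \<le> s n x" for n x using t0 by (auto simp: s_def intro: sum_nonneg)
  have sm: "s n x \<le> s m x" if "n \<le> m" for n m x
  proof -
    have "s n x \<le> (\<Sum>i<n. t m i x)" unfolding s_def using tm[OF that] by (intro sum_mono)
    also have "\<dots> \<le> s m x" unfolding s_def using that t0 by (intro sum_mono2) auto
    finally show ?thesis .
  qed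
  define h where "h n x = max (f x - s n x) 0" for n x
  have h: "bounded_continuous_on S (h n)" for n
    unfolding h_def by (intro bounded_continuous_on_max bounded_continuous_on_diff bf bs)
  have lim: "(\<lambda>n. h n x) \<longlonglongrightarrow> 0" if x: "x \<in> S" for x
  proof -
    have "\<exists>N. s N x \<ge> f x"
    proof (cases "x \<in> (\<Union>i. G i)")
      case True
      then obtain i where i: "x \<in> G i" by auto
      then have pos: "0 < d i x" using d(3) by auto
      obtain N0 :: nat where N0: "1 < real N0 * d i x" using ex_less_of_nat_mult[OF pos] by auto
      define N where "N = max N0 (Suc i)"
      have "real N0 * d i x \<le> real N * d i x" using pos by (intro mult_right_mono) (auto simp: N_def)
      then have "t N i x = 1" using N0 by (auto simp: t_def)
      moreover have "t N i x \<le> s N x" unfolding s_def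
        by (rule member_le_sum) (auto simp: N_def t0)
      ultimately show ?thesis using f01[OF x] by (auto intro!: exI[of _ N])
    next
      case False
      then show ?thesis using f0[OF x] s0 by auto
    qed
    then obtain N where N: "f x \<le> s N x" by blast
    have "h n x = 0" if "n \<ge> N" for n using N sm[OF that, of x] by (auto simp: h_def)
    then show ?thesis by (intro tendsto_eventually eventually_sequentiallyI)
  qed
  have "ennreal (L f) \<le> (\<Sum>i. content (G i)) + ennreal e" if "0 < e" for e
  proof -
    have "\<exists>n. L (h n) \<le> e"
    proof (rule decreasing_to_zero[OF h _ _ lim that])
      show "0 \<le> h n x \<and> h n x \<le> 1" if "x \<in> S" for n x
        using f01[OF that] s0[of n x] by (auto simp: h_def)
      show "decseq (\<lambda>n. h n x)" for x
        unfolding decseq_def h_def using sm by (intro allI impI max.mono diff_left_mono) auto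
    qed
    then obtain n where n: "L (h n) \<le> e" by blast
    have "L f \<le> L (\<lambda>x. s n x + h n x)"
      by (rule mono[OF bf bounded_continuous_on_add[OF bs h]]) (auto simp: h_def)
    also have "\<dots> = (\<Sum>i<n. L (t n i)) + L (h n)"
      using add[OF bs h] sum[of "{..<n}" "t n", OF _ bt] by (simp add: s_def[abs_def])
    also have "\<dots> \<le> (\<Sum>i<n. L (t n i)) + e" using n by simp
    finally have "ennreal (L f) \<le> ennreal ((\<Sum>i<n. L (t n i)) + e)" by (rule ennreal_leI)
    also have "\<dots> = (\<Sum>i<n. ennreal (L (t n i))) + ennreal e"
      using bumps_nonneg[OF t] that by (simp add: ennreal_plus sum_nonneg sum_ennreal)
    also have "\<dots> \<le> (\<Sum>i<n. content (G i)) + ennreal e"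
      by (intro add_right_mono sum_mono content_upper t)
    also have "\<dots> \<le> (\<Sum>i. content (G i)) + ennreal e"
      by (intro add_right_mono sum_le_suminf) auto
    finally show ?thesis .
  qed
  then show "ennreal (L f) \<le> (\<Sum>i. content (G i))"
    by (rule ennreal_le_epsilon)
qed


text \<open>The inequality that makes open sets measurable. A function \<open>f\<close> supported in \<open>E \<inter> G\<close>, lowered by \<open>e\<close>, has
  support disjoint from the open set \<open>{f < e}\<close>, which contains \<open>S \<inter> E - G\<close>. So it can be added to any
  function that counts for the content of \<open>E \<inter> {f < e}\<close> without exceeding \<open>1\<close>.\<close>

lemma content_split:
  assumes "open E" "open G"
  shows "content (E \<inter> G) + outer (S \<inter> E - G) \<le> content E"
proof (rule ennreal_le_epsilon)
  fix e :: real assume e: "0 < e"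
  have main: "ennreal (L f) + outer (S \<inter> E - G) \<le> content E + ennreal e" if f: "f \<in> bumps (E \<inter> G)" for f
  proof -
    have bf: "bounded_continuous_on S f" and f01: "\<And>x. x \<in> S \<Longrightarrow> 0 \<le> f x \<and> f x \<le> 1"
      and f0: "\<And>x. x \<in> S \<Longrightarrow> x \<notin> E \<inter> G \<Longrightarrow> f x = 0" using f by (auto simp: bumps_def)
    obtain W where W: "open W" "W \<inter> S = f -` {..<e} \<inter> S"
      using bf unfolding bounded_continuous_on_def continuous_on_open_invariant
      by (metis open_lessThan)
    define f' where "f' x = max (f x - e) 0" for x
    have bf': "bounded_continuous_on S f'"
      unfolding f'_def by (intro bounded_continuous_on_max bounded_continuous_on_diff bf bounded_continuous_on_const)
    have "L f \<le> L (\<lambda>x. e + f' x)"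
      by (intro mono bounded_continuous_on_add bounded_continuous_on_const bf bf') (auto simp: f'_def)
    also have "\<dots> = e + L f'" using add[OF bounded_continuous_on_const bf'] const by simp
    finally have Lf: "L f \<le> e + L f'" .
    have f'0: "0 \<le> L f'" by (rule nonneg[OF bf']) (simp add: f'_def)
    have "content (E \<inter> W) + ennreal (L f') \<le> content E"
    proof -
      have "ennreal (L h) + ennreal (L f') \<le> content E" if h: "h \<in> bumps (E \<inter> W)" for h
      proof -
        have bh: "bounded_continuous_on S h" using h by (auto simp: bumps_def)
        have "(\<lambda>x. h x + f' x) \<in> bumps E"
          unfolding bumps_def
        proof (intro CollectI conjI ballI)
          show "bounded_continuous_on S (\<lambda>x. h x + f' x)" by (rule bounded_continuous_on_add[OF bh bf'])
          fix x assume x: "x \<in> S"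
          have h01: "0 \<le> h x" "h x \<le> 1" "x \<notin> W \<Longrightarrow> h x = 0" using h x by (auto simp: bumps_def)
          have "x \<in> W \<longleftrightarrow> f x < e" using W(2) x by auto
          then show "0 \<le> h x + f' x" "h x + f' x \<le> 1"
            using h01 f01[OF x] e by (auto simp: f'_def max_def)
        next
          fix x assume x: "x \<in> S - E"
          then show "h x + f' x = 0" using h f0[of x] e by (auto simp: bumps_def f'_def)
        qed
        then have "ennreal (L (\<lambda>x. h x + f' x)) \<le> content E" by (rule content_upper)
        then show ?thesis using add[OF bh bf'] bumps_nonneg[OF h] f'0 by simp
      qed
      moreover have "(\<lambda>_. 0) \<in> bumps (E \<inter> W)"
        by (auto simp: bumps_def bounded_continuous_on_const)
      ultimately show ?thesis
        unfolding content_def[of "E \<inter> W"]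
        by (subst ennreal_SUP_add_left[symmetric]) (auto intro!: SUP_least)
    qed
    moreover have "outer (S \<inter> E - G) \<le> content (E \<inter> W)"
      unfolding outer_def
    proof (rule INF_lower, intro CollectI conjI)
      show "open (E \<inter> W)" using assms(1) W(1) by auto
      have "x \<in> W" if "x \<in> S" "x \<notin> G" for x using f0[of x] that W(2) e by auto
      then show "S \<inter> E - G \<subseteq> E \<inter> W" by auto
    qed
    ultimately have "outer (S \<inter> E - G) + ennreal (L f') \<le> content E"
      by (meson add_right_mono order_trans)
    moreover have "ennreal (L f) \<le> ennreal e + ennreal (L f')"
      using ennreal_leI[OF Lf] e f'0 by simp
    ultimately have "ennreal (L f) + outer (S \<inter> E - G) \<le> (ennreal e + ennreal (L f')) + outer (S \<inter> E - G)"
      by (intro add_right_mono)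
    also have "\<dots> \<le> content E + ennreal e"
      using add_left_mono[OF \<open>outer (S \<inter> E - G) + ennreal (L f') \<le> content E\<close>, of "ennreal e"]
      by (simp only: ac_simps)
    finally show ?thesis .
  qed
  moreover have "(\<lambda>_. 0) \<in> bumps (E \<inter> G)"
    by (auto simp: bumps_def bounded_continuous_on_const)
  ultimately show "content (E \<inter> G) + outer (S \<inter> E - G) \<le> content E + ennreal e"
    unfolding content_def[of "E \<inter> G"]
    by (subst ennreal_SUP_add_left[symmetric]) (auto intro!: SUP_least)
qed

lemma outer_mono: "X \<subseteq> Y \<Longrightarrow> outer X \<le> outer Y"
  unfolding outer_def by (rule INF_superset_mono) auto

lemma outer_le_content: "open G \<Longrightarrow> X \<subseteq> G \<Longrightarrow> outer X \<le> content G"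
  unfolding outer_def by (rule INF_lower) auto

lemma outer_countably_subadditive: "outer (\<Union>i. X i) \<le> (\<Sum>i::nat. outer (X i))"
proof (rule ennreal_le_epsilon)
  fix e :: real assume e: "0 < e"
  have "\<exists>G. open G \<and> X i \<subseteq> G \<and> content G \<le> outer (X i) + ennreal (e * (1/2) ^ Suc i)" for i
  proof -
    have "outer (X i) \<le> content UNIV" by (rule outer_le_content) auto
    also have "\<dots> \<le> 1" by (rule content_le_one)
    finally have "outer (X i) \<noteq> top" by (auto simp: top_unique)
    then have "\<exists>G\<in>{G. open G \<and> X i \<subseteq> G}. content G < outer (X i) + ennreal (e * (1/2) ^ Suc i)"
      using e by (intro INF_approx_ennreal[OF _ outer_def]) auto
    then show ?thesis by (auto intro: less_imp_le)
  qed
  then obtain G where G: "\<And>i. open (G i)" "\<And>i. X i \<subseteq> G i"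
    "\<And>i. content (G i) \<le> outer (X i) + ennreal (e * (1/2) ^ Suc i)" by metis
  have sums: "(\<lambda>i. e * (1/2) ^ Suc i) sums e" using sums_mult[OF power_half_series, of e] by simp
  have "outer (\<Union>i. X i) \<le> content (\<Union>i. G i)"
    using G by (intro outer_le_content) auto
  also have "\<dots> \<le> (\<Sum>i. content (G i))" by (rule content_countably_subadditive[OF G(1)])
  also have "\<dots> \<le> (\<Sum>i. outer (X i) + ennreal (e * (1/2) ^ Suc i))"
    using G(3) by (intro suminf_le) auto
  also have "\<dots> = (\<Sum>i. outer (X i)) + (\<Sum>i. ennreal (e * (1/2) ^ Suc i))"
    by (rule suminf_add[symmetric]) auto
  also have "(\<Sum>i. ennreal (e * (1/2) ^ Suc i)) = ennreal e"
    using e by (intro suminf_ennreal_eq[OF _ sums]) auto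
  finally show "outer (\<Union>i. X i) \<le> (\<Sum>i. outer (X i)) + ennreal e" .
qed

lemma outer_measure_space_outer: "outer_measure_space (Pow S) outer"
  unfolding outer_measure_space_def
proof (intro conjI)
  have "outer {} \<le> content {}" by (rule outer_le_content) auto
  then show "positive (Pow S) outer" by (simp add: positive_def content_empty)
  show "increasing (Pow S) outer" by (auto simp: increasing_def intro: outer_mono)
  show "countably_subadditive (Pow S) outer"
    unfolding countably_subadditive_def using outer_countably_subadditive by auto
qed

lemma open_in_lambda_system:
  assumes "open G"
  shows "S \<inter> G \<in> lambda_system S (Pow S) outer"
  unfolding lambda_system_def
proof (intro CollectI conjI ballI antisym)
  fix X assume X: "X \<in> Pow S"
  have split: "S \<inter> G \<inter> X = X \<inter> G" "(S - S \<inter> G) \<inter> X = X - G" using X by auto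
  show "outer (S \<inter> G \<inter> X) + outer ((S - S \<inter> G) \<inter> X) \<le> outer X"
    unfolding outer_def[of X]
  proof (rule INF_greatest)
    fix E assume E: "E \<in> {E. open E \<and> X \<subseteq> E}"
    have "outer (X \<inter> G) \<le> outer (S \<inter> (E \<inter> G))" "outer (X - G) \<le> outer (S \<inter> E - G)"
      using E X by (auto intro!: outer_mono)
    moreover have "outer (S \<inter> (E \<inter> G)) = content (E \<inter> G)"
      using E assms by (intro outer_open) auto
    ultimately have "outer (X \<inter> G) + outer (X - G) \<le> content (E \<inter> G) + outer (S \<inter> E - G)"
      by (metis add_mono)
    also have "\<dots> \<le> content E" using content_split[of E G] E assms by auto
    finally show "outer (S \<inter> G \<inter> X) + outer ((S - S \<inter> G) \<inter> X) \<le> content E" unfolding split .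
  qed
  have "subadditive (Pow S) outer"
    using outer_measure_space_outer unfolding outer_measure_space_def
    by (intro ring_of_sets.countably_subadditive_subadditive[of S])
       (auto intro: algebra.axioms(1) sigma_algebra.axioms(1) sigma_algebra_Pow)
  then have "outer ((X \<inter> G) \<union> (X - G)) \<le> outer (X \<inter> G) + outer (X - G)"
    using X by (intro subadditiveD[of "Pow S" outer]) auto
  moreover have "(X \<inter> G) \<union> (X - G) = X" by auto
  ultimately show "outer X \<le> outer (S \<inter> G \<inter> X) + outer ((S - S \<inter> G) \<inter> X)" unfolding split by simp
qed auto

text \<open>The outer measure is a measure on all Caratheodory-measurable sets; pushing it forward along the identity
  restricts it to the Borel sets.\<close>

definition representing_measure :: "'a measure" where
  "representing_measure =
    distr (measure_of S (lambda_system S (Pow S) outer) outer) (borel_on S) (\<lambda>x. x)"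

lemma emeasure_representing_measure:
  assumes G: "open G"
  shows "emeasure representing_measure (S \<inter> G) = content G"
proof -
  let ?\<Lambda> = "lambda_system S (Pow S) outer"
  let ?N = "measure_of S ?\<Lambda> outer"
  have ms: "measure_space S ?\<Lambda> outer"
    by (rule sigma_algebra.caratheodory_lemma[OF sigma_algebra_Pow outer_measure_space_outer])
  then have sa: "sigma_algebra S ?\<Lambda>" by (simp add: measure_space_def)
  have sub: "?\<Lambda> \<subseteq> Pow S" by (auto simp: lambda_system_def)
  have setsN: "sets ?N = ?\<Lambda>" using sigma_algebra.sets_measure_of_eq[OF sa] .
  have spaceN: "space ?N = S" using sub by (rule space_measure_of)
  have "(\<lambda>x. x) \<in> borel_measurable ?N"
  proof (rule borel_measurableI)
    fix H :: "'a set" assume "open H"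
    then show "(\<lambda>x. x) -` H \<inter> space ?N \<in> sets ?N"
      using open_in_lambda_system[of H] unfolding setsN spaceN by (simp add: Int_commute)
  qed
  then have meas: "(\<lambda>x. x) \<in> measurable ?N (borel_on S)"
    by (intro measurable_restrict_space2) (auto simp: spaceN)
  have "S \<inter> G \<in> sets (borel_on S)" using G by (auto simp: sets_restrict_space)
  then have "emeasure representing_measure (S \<inter> G) = emeasure ?N ((\<lambda>x. x) -` (S \<inter> G) \<inter> space ?N)"
    unfolding representing_measure_def by (rule emeasure_distr[OF meas])
  also have "(\<lambda>x. x) -` (S \<inter> G) \<inter> space ?N = S \<inter> G" unfolding spaceN by auto
  also have "emeasure ?N (S \<inter> G) = outer (S \<inter> G)"
    using ms open_in_lambda_system[OF G]
    by (intro emeasure_measure_of_sigma[OF sa]) (auto simp: measure_space_def)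
  also have "\<dots> = content G" by (rule outer_open[OF G])
  finally show ?thesis .
qed

lemma representing_measure_in_prob_measures: "representing_measure \<in> prob_measures S"
proof -
  have "(\<lambda>_. 1) \<in> bumps UNIV" by (auto simp: bumps_def bounded_continuous_on_const)
  then have "content UNIV = 1"
    using content_upper[of "\<lambda>_. 1" UNIV] content_le_one[of UNIV] by (intro antisym) (simp_all add: one)
  then have "emeasure representing_measure (S \<inter> UNIV) = 1"
    using emeasure_representing_measure[of UNIV] by simp
  then have "prob_space representing_measure"
    by (intro prob_spaceI) (simp add: representing_measure_def space_restrict_space)
  then show ?thesis
    by (simp add: prob_measures_def representing_measure_def)
qed

text \<open>Cut \<open>f\<close> into \<open>n\<close> horizontal layers of height \<open>1 / n\<close>. The layer above height \<open>j / n\<close>, rescaled to height \<open>1\<close>, is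
  admissible for the content of \<open>{f > j / n}\<close>; and the step function with steps \<open>1 / n\<close> on these sets
  exceeds \<open>f\<close> by at most \<open>1 / n\<close>.\<close>

lemma le_integral_representing_measure:
  assumes bf: "bounded_continuous_on S f" and f01: "\<And>x. x \<in> S \<Longrightarrow> 0 \<le> f x \<and> f x \<le> 1"
  shows "L f \<le> (\<integral>x. f x \<partial>representing_measure)"
proof -
  let ?M = representing_measure
  have pm: "?M \<in> prob_measures S" by (rule representing_measure_in_prob_measures)
  interpret prob_space ?M using pm by (simp add: prob_measures_def)
  note setsM = sets_prob_measures[OF pm] and spaceM = space_prob_measures[OF pm]
  have step: "L f \<le> (\<integral>x. f x \<partial>?M) + 1 / real n" if n: "0 < n" for n :: nat
  proof -
    define p where "p j x = max (min (f x - real j / n) (1 / n)) 0" for j x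
    have bp: "bounded_continuous_on S (p j)" for j
      unfolding p_def
      by (intro bounded_continuous_on_max bounded_continuous_on_min bounded_continuous_on_diff
          bounded_continuous_on_const bf)
    have psum: "(\<Sum>j<m. p j x) = min (f x) (real m / n)" if "x \<in> S" for m x
    proof (induction m)
      case 0
      then show ?case using f01[OF that] by simp
    next
      case (Suc m)
      have "real (Suc m) / n = real m / n + 1 / n" by (simp add: add_divide_distrib)
      moreover have "0 < 1 / real n" using n by simp
      ultimately show ?case unfolding sum.lessThan_Suc Suc.IH unfolding p_def by linarith
    qed
    have "\<exists>W. open W \<and> W \<inter> S = f -` {real j / n<..} \<inter> S" for j
      using bf unfolding bounded_continuous_on_def continuous_on_open_invariant
      by (metis open_greaterThan)
    then obtain W where W: "\<And>j. open (W j)" "\<And>j. W j \<inter> S = f -` {real j / n<..} \<inter> S" by metis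
    have W': "x \<in> S \<inter> W j \<longleftrightarrow> real j / n < f x" if "x \<in> S" for x j
      using W(2)[of j] that by auto
    have Wm: "S \<inter> W j \<in> sets ?M" for j using W(1) by (auto simp: setsM sets_restrict_space)
    have Lp: "L (p j) \<le> (1 / n) * measure ?M (S \<inter> W j)" for j
    proof -
      have "(\<lambda>x. n * p j x) \<in> bumps (W j)"
        unfolding bumps_def
      proof (intro CollectI conjI ballI)
        show "bounded_continuous_on S (\<lambda>x. n * p j x)" by (rule bounded_continuous_on_scale[OF bp])
        have "p j x \<le> 1 / n" for x by (simp add: p_def)
        then show "n * p j x \<le> 1" for x using n by (simp add: field_simps)
        show "0 \<le> n * p j x" for x by (simp add: p_def)
        show "n * p j x = 0" if "x \<in> S - W j" for x
        proof -
          have "f x \<le> real j / n" using W'[of x j] that by auto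
          then show ?thesis by (simp add: p_def)
        qed
      qed
      then have "ennreal (L (\<lambda>x. n * p j x)) \<le> emeasure ?M (S \<inter> W j)"
        using content_upper emeasure_representing_measure[OF W(1)] by metis
      then have "n * L (p j) \<le> measure ?M (S \<inter> W j)"
        by (simp add: scale[OF bp] emeasure_eq_measure)
      then show ?thesis using n by (simp add: field_simps)
    qed
    have "L f = L (\<lambda>x. \<Sum>j<n. p j x)"
      using psum[of _ n] n f01 by (intro cong bf bounded_continuous_on_sum bp) auto
    also have "\<dots> = (\<Sum>j<n. L (p j))" by (rule sum) (auto simp: bp)
    also have "\<dots> \<le> (\<Sum>j<n. (1 / n) * measure ?M (S \<inter> W j))" by (intro sum_mono Lp)
    also have "\<dots> = (\<integral>x. (\<Sum>j<n. (1 / n) * indicator (S \<inter> W j) x) \<partial>?M)"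
      using Wm by (subst Bochner_Integration.integral_sum) (auto simp: less_top[symmetric])
    also have "\<dots> \<le> (\<integral>x. f x + 1 / n \<partial>?M)"
    proof (rule integral_mono)
      show "integrable ?M (\<lambda>x. \<Sum>j<n. (1 / n) * indicator (S \<inter> W j) x)"
        using Wm by (auto simp: less_top[symmetric])
      show "integrable ?M (\<lambda>x. f x + 1 / n)"
        using bounded_continuous_on_imp_integrable[OF pm bf] by auto
      fix x assume "x \<in> space ?M"
      then have x: "x \<in> S" by (simp add: spaceM)
      have "(\<Sum>j<m. (1 / n) * indicator (S \<inter> W j) x) \<le> min (f x + 1 / n) (real m / n)" for m
      proof (induction m)
        case 0
        then show ?case using f01[OF x] by simp
      next
        case (Suc m)
        have eq: "real (Suc m) / n = real m / n + 1 / n" by (simp add: add_divide_distrib)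
        have pos: "0 < 1 / real n" using n by simp
        show ?case
        proof (cases "real m / n < f x")
          case True
          then have "x \<in> S \<inter> W m" using W'[OF x] by simp
          then show ?thesis using Suc True pos unfolding eq by simp
        next
          case False
          then have "x \<notin> S \<inter> W m" using W'[OF x] by simp
          then have "(1 / n) * indicator (S \<inter> W m) x = (0::real)" by simp
          then show ?thesis using Suc pos unfolding eq sum.lessThan_Suc by linarith
        qed
      qed
      from this[of n] show "(\<Sum>j<n. (1 / n) * indicator (S \<inter> W j) x) \<le> f x + 1 / n" by simp
    qed
    also have "\<dots> = (\<integral>x. f x \<partial>?M) + 1 / n"
      using bounded_continuous_on_imp_integrable[OF pm bf] by (simp add: prob_space)
    finally show ?thesis .
  qed
  have "(\<lambda>n. (\<integral>x. f x \<partial>?M) + 1 / real n) \<longlonglongrightarrow> (\<integral>x. f x \<partial>?M) + 0"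
    by (intro tendsto_intros lim_1_over_n)
  then show ?thesis
    using step by (intro LIMSEQ_le_const[where X = "\<lambda>n. (\<integral>x. f x \<partial>?M) + 1 / real n"]) (auto intro!: exI[of _ 1])
qed

text \<open>One inequality suffices: for \<open>0 \<le> h \<le> 1\<close> it applies to both \<open>h\<close> and \<open>1 - h\<close>. A bounded \<open>f\<close> is reduced to this
  case by an affine change of scale.\<close>

theorem representation:
  assumes bf: "bounded_continuous_on S f"
  shows "L f = (\<integral>x. f x \<partial>representing_measure)"
proof -
  let ?M = representing_measure
  have pm: "?M \<in> prob_measures S" by (rule representing_measure_in_prob_measures)
  interpret prob_space ?M using pm by (simp add: prob_measures_def)
  obtain K0 where "\<And>x. x \<in> S \<Longrightarrow> \<bar>f x\<bar> \<le> K0" using bf by (rule bounded_continuous_onE) blast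
  then have K: "\<bar>f x\<bar> \<le> \<bar>K0\<bar> + 1" if "x \<in> S" for x using that by fastforce
  define K where "K = \<bar>K0\<bar> + 1"
  have Kpos: "0 < K" by (simp add: K_def)
  define h where "h x = (1 / (2 * K)) * (f x + K)" for x
  have bh: "bounded_continuous_on S h"
    unfolding h_def by (intro bounded_continuous_on_scale bounded_continuous_on_add bounded_continuous_on_const bf)
  have h01: "0 \<le> h x \<and> h x \<le> 1" if "x \<in> S" for x
    using K[OF that] Kpos unfolding h_def K_def[symmetric] by (auto simp: field_simps abs_le_iff)
  have ih: "integrable ?M h" and iff: "integrable ?M f"
    using bounded_continuous_on_imp_integrable[OF pm] bh bf by auto
  have "L h \<le> (\<integral>x. h x \<partial>?M)" by (rule le_integral_representing_measure[OF bh h01])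
  moreover have "L (\<lambda>x. 1 - h x) \<le> (\<integral>x. 1 - h x \<partial>?M)"
    using h01 by (intro le_integral_representing_measure bounded_continuous_on_diff bounded_continuous_on_const bh) auto
  then have "1 - L h \<le> 1 - (\<integral>x. h x \<partial>?M)"
    using ih by (simp add: diff[OF bounded_continuous_on_const bh] const prob_space)
  ultimately have "L h = (\<integral>x. h x \<partial>?M)" by simp
  moreover have "L h = (1 / (2 * K)) * (L f + K)"
    unfolding h_def scale[OF bounded_continuous_on_add[OF bf bounded_continuous_on_const]]
      add[OF bf bounded_continuous_on_const] const ..
  moreover have "(\<integral>x. h x \<partial>?M) = (1 / (2 * K)) * ((\<integral>x. f x \<partial>?M) + K)"
    unfolding h_def using iff by (simp add: prob_space)
  ultimately show ?thesis using Kpos by simp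
qed

end

section \<open>Semicontinuous integrands\<close>

text \<open>The integrands \<open>U - c a\<close> and the indicators of open sets are real-valued, so the property is stated for
  real functions; the \<open>\<epsilon>\<close>-form avoids a limit inferior over the possibly trivial filter at an isolated point.\<close>

definition lsc_on :: "'a::metric_space set \<Rightarrow> ('a \<Rightarrow> real) \<Rightarrow> bool" where
  "lsc_on S g \<longleftrightarrow> (\<forall>x\<in>S. \<forall>r<g x. \<exists>e>0. \<forall>y\<in>S. dist y x < e \<longrightarrow> r < g y)"

text \<open>The approximants are the Lipschitz regularisations \<open>x \<mapsto> INF y. g y + n * dist x y\<close>, truncated at \<open>n\<close>. They are monotone in
  \<open>n\<close> on the whole space, which the monotone convergence theorem uses.\<close>

lemma lsc_on_approx_from_below:
  fixes S :: "'a::metric_space set"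
  assumes lsc: "lsc_on S g" and g0: "\<And>x. x \<in> S \<Longrightarrow> 0 \<le> g x"
  obtains f :: "nat \<Rightarrow> 'a \<Rightarrow> real" where
    "\<And>n. bounded_continuous_on S (f n)" "\<And>n x. 0 \<le> f n x" "\<And>n x. x \<in> S \<Longrightarrow> f n x \<le> g x"
    "\<And>x. incseq (\<lambda>n. f n x)" "\<And>x. x \<in> S \<Longrightarrow> (\<lambda>n. f n x) \<longlonglongrightarrow> g x"
proof (cases "S = {}")
  case True
  then show ?thesis
    by (intro that[of "\<lambda>_ _. 0"]) (auto simp: bounded_continuous_on_const incseq_def)
next
  case False
  define h where "h n x = (INF y\<in>S. g y + real n * dist x y)" for n x
  have bdd: "bdd_below ((\<lambda>y. g y + real n * dist x y) ` S)" for n x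
    using g0 by (intro bdd_belowI[of _ 0]) (auto intro!: add_nonneg_nonneg)
  have h0: "0 \<le> h n x" for n x
    unfolding h_def using False g0 by (intro cINF_greatest) (auto intro!: add_nonneg_nonneg)
  have h_le: "h n x \<le> g y + real n * dist x y" if "y \<in> S" for n x y
    unfolding h_def by (rule cINF_lower[OF bdd that])
  have hg: "h n x \<le> g x" if "x \<in> S" for n x using h_le[OF that, of n x] by simp
  have h_mono: "h n x \<le> h m x" if "n \<le> m" for n m x
    unfolding h_def[of m] using False
  proof (rule cINF_greatest)
    fix y assume "y \<in> S"
    have "real n * dist x y \<le> real m * dist x y" using that by (intro mult_right_mono) auto
    then show "h n x \<le> g y + real m * dist x y" using h_le[OF \<open>y \<in> S\<close>, of n x] by linarith
  qed
  have lip: "h n x - real n * dist x x' \<le> h n x'" for n x x'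
    unfolding h_def[of n x'] using False
  proof (rule cINF_greatest)
    fix y assume "y \<in> S"
    have "real n * dist x y \<le> real n * (dist x x' + dist x' y)"
      by (intro mult_left_mono dist_triangle) auto
    then show "h n x - real n * dist x x' \<le> g y + real n * dist x' y"
      using h_le[OF \<open>y \<in> S\<close>, of n x] by (simp add: distrib_left)
  qed
  have cont: "continuous_on S (h n)" for n
  proof -
    have "\<bar>h n x - h n x'\<bar> \<le> real n * dist x x'" for x x'
      using lip[of n x x'] lip[of n x' x] by (simp add: dist_commute abs_le_iff)
    then have "(real n)-lipschitz_on S (h n)" by (intro lipschitz_onI) (auto simp: dist_real_def)
    then show ?thesis by (rule lipschitz_on_continuous_on)
  qed
  have low: "\<exists>N. \<forall>n\<ge>N. r \<le> h n x" if x: "x \<in> S" and r: "r < g x" for r x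
  proof -
    obtain e where e: "0 < e" "\<And>y. y \<in> S \<Longrightarrow> dist y x < e \<Longrightarrow> r < g y"
      using lsc x r unfolding lsc_on_def by blast
    obtain N :: nat where N: "r < real N * e" using ex_less_of_nat_mult[OF e(1)] by auto
    have "r \<le> h n x" if "N \<le> n" for n
      unfolding h_def using False
    proof (rule cINF_greatest)
      fix y assume y: "y \<in> S"
      show "r \<le> g y + real n * dist x y"
      proof (cases "dist y x < e")
        case True
        then have "r < g y" by (rule e(2)[OF y])
        moreover have "0 \<le> real n * dist x y" by simp
        ultimately show ?thesis by linarith
      next
        case False
        have "real N * e \<le> real n * dist x y"
          using False that e(1) by (intro mult_mono) (auto simp: dist_commute)
        then show ?thesis using N g0[OF y] by linarith
      qed
    qed
    then show ?thesis by blast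
  qed
  define f where "f n x = min (h n x) (real n)" for n x
  show ?thesis
  proof
    show "bounded_continuous_on S (f n)" for n
      unfolding f_def
    proof (rule bounded_continuous_onI[where M = "real n"])
      show "continuous_on S (\<lambda>x. min (h n x) (real n))" by (intro continuous_intros cont)
      show "\<bar>min (h n x) (real n)\<bar> \<le> real n" for x using h0[of n x] by linarith
    qed
    show "0 \<le> f n x" for n x using h0 by (simp add: f_def)
    show fg: "f n x \<le> g x" if "x \<in> S" for n x
      using hg[OF that, of n] by (simp add: f_def min.coboundedI1)
    show "incseq (\<lambda>n. f n x)" for x
      unfolding incseq_def f_def by (intro allI impI min.mono h_mono) auto
    fix x assume x: "x \<in> S"
    show "(\<lambda>n. f n x) \<longlonglongrightarrow> g x"
    proof (rule order_tendstoI)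
      fix a assume "a < g x"
      then obtain r where r: "a < r" "r < g x" using dense by blast
      obtain N where N: "\<And>n. N \<le> n \<Longrightarrow> r \<le> h n x" using low[OF x r(2)] by blast
      obtain K :: nat where K: "r \<le> real K" using real_arch_simple by blast
      have "a < f n x" if "max N K \<le> n" for n
        using N[of n] K that r(1) unfolding f_def by auto
      then show "\<forall>\<^sub>F n in sequentially. a < f n x" by (rule eventually_sequentiallyI)
    next
      fix a assume "g x < a"
      then show "\<forall>\<^sub>F n in sequentially. f n x < a"
        using fg[OF x] by (intro always_eventually allI) (metis le_less_trans)
    qed
  qed
qed

text \<open>This turns a bound on a possibly infinite integral of a semicontinuous function into a family of
  conditions that are continuous in the weak topology.\<close>

lemma nn_integral_lsc_le_iff:
  fixes S :: "'a::metric_space set"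
  assumes M: "M \<in> prob_measures S" and lsc: "lsc_on S g" and g0: "\<And>x. x \<in> S \<Longrightarrow> 0 \<le> g x" and k: "0 \<le> k"
  shows "(\<integral>\<^sup>+x. ennreal (g x) \<partial>M) \<le> ennreal k \<longleftrightarrow>
    (\<forall>f. bounded_continuous_on S f \<longrightarrow> (\<forall>x\<in>S. 0 \<le> f x \<and> f x \<le> g x) \<longrightarrow> (\<integral>x. f x \<partial>M) \<le> k)"
proof -
  have eq: "(\<integral>\<^sup>+x. ennreal (f x) \<partial>M) = ennreal (\<integral>x. f x \<partial>M)"
    if "bounded_continuous_on S f" "\<And>x. x \<in> S \<Longrightarrow> 0 \<le> f x" for f
    using that by (intro nn_integral_eq_integral bounded_continuous_on_imp_integrable[OF M] AE_I2)
      (auto simp: space_prob_measures[OF M])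
  show ?thesis
  proof (intro iffI allI impI)
    fix f assume le: "(\<integral>\<^sup>+x. ennreal (g x) \<partial>M) \<le> ennreal k"
      and f: "bounded_continuous_on S f" "\<forall>x\<in>S. 0 \<le> f x \<and> f x \<le> g x"
    have "ennreal (\<integral>x. f x \<partial>M) = (\<integral>\<^sup>+x. ennreal (f x) \<partial>M)" using f by (intro eq[symmetric]) auto
    also have "\<dots> \<le> (\<integral>\<^sup>+x. ennreal (g x) \<partial>M)"
      using f by (intro nn_integral_mono) (auto simp: space_prob_measures[OF M] intro!: ennreal_leI)
    finally show "(\<integral>x. f x \<partial>M) \<le> k" using le k by (metis ennreal_le_iff order_trans)
  next
    assume R: "\<forall>f. bounded_continuous_on S f \<longrightarrow> (\<forall>x\<in>S. 0 \<le> f x \<and> f x \<le> g x) \<longrightarrow> (\<integral>x. f x \<partial>M) \<le> k"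
    obtain f :: "nat \<Rightarrow> 'a \<Rightarrow> real" where
      f: "\<And>n. bounded_continuous_on S (f n)" "\<And>n x. 0 \<le> f n x" "\<And>n x. x \<in> S \<Longrightarrow> f n x \<le> g x"
        "\<And>x. incseq (\<lambda>n. f n x)" "\<And>x. x \<in> S \<Longrightarrow> (\<lambda>n. f n x) \<longlonglongrightarrow> g x"
      using lsc_on_approx_from_below[OF lsc g0] by blast
    have inc: "incseq (\<lambda>n x. ennreal (f n x))"
      using f(4) by (auto simp: incseq_def le_fun_def intro!: ennreal_leI)
    have "(\<integral>\<^sup>+x. ennreal (g x) \<partial>M) = (\<integral>\<^sup>+x. (SUP n. ennreal (f n x)) \<partial>M)"
    proof (rule nn_integral_cong)
      fix x assume "x \<in> space M"
      then have x: "x \<in> S" by (simp add: space_prob_measures[OF M])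
      have "(\<lambda>n. ennreal (f n x)) \<longlonglongrightarrow> (SUP n. ennreal (f n x))"
        using inc by (intro LIMSEQ_SUP) (auto simp: incseq_def le_fun_def)
      moreover have "(\<lambda>n. ennreal (f n x)) \<longlonglongrightarrow> ennreal (g x)"
        by (intro tendsto_ennrealI f(5) x)
      ultimately show "ennreal (g x) = (SUP n. ennreal (f n x))" by (rule LIMSEQ_unique[symmetric])
    qed
    also have "\<dots> = (SUP n. (\<integral>\<^sup>+x. ennreal (f n x) \<partial>M))"
      using bounded_continuous_on_imp_integrable[OF M f(1)]
      by (intro nn_integral_monotone_convergence_SUP inc) auto
    also have "\<dots> \<le> ennreal k"
    proof (rule SUP_least)
      fix n
      have "(\<integral>x. f n x \<partial>M) \<le> k" using R f(1)[of n] f(2,3) by blast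
      then show "(\<integral>\<^sup>+x. ennreal (f n x) \<partial>M) \<le> ennreal k" using eq[OF f(1,2)] by (simp add: ennreal_leI)
    qed
    finally show "(\<integral>\<^sup>+x. ennreal (g x) \<partial>M) \<le> ennreal k" .
  qed
qed

text \<open>The indicator of an open set is lower semicontinuous, so the integrals of bounded continuous functions
  determine the measure on open sets, which generate the Borel sets.\<close>

lemma prob_measures_eqI:
  fixes S :: "'a::metric_space set"
  assumes M: "M \<in> prob_measures S" and N: "N \<in> prob_measures S"
    and eq: "\<And>f. bounded_continuous_on S f \<Longrightarrow> (\<integral>x. f x \<partial>M) = (\<integral>x. f x \<partial>N)"
  shows "M = N"
proof -
  interpret M: prob_space M using M by (simp add: prob_measures_def)
  interpret N: prob_space N using N by (simp add: prob_measures_def)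
  have open_eq: "emeasure M (S \<inter> G) = emeasure N (S \<inter> G)" if G: "open G" for G
  proof -
    define g where "g = (indicator G :: 'a \<Rightarrow> real)"
    have lsc: "lsc_on S g"
      unfolding lsc_on_def
    proof (intro ballI allI impI)
      fix x r assume "x \<in> S" and r: "r < g x"
      show "\<exists>e>0. \<forall>y\<in>S. dist y x < e \<longrightarrow> r < g y"
      proof (cases "x \<in> G")
        case True
        then obtain e where "e > 0" "\<And>y. dist y x < e \<Longrightarrow> y \<in> G"
          using G unfolding open_dist by blast
        then show ?thesis using r True by (intro exI[of _ e]) (auto simp: g_def)
      next
        case False
        then show ?thesis using r by (intro exI[of _ 1]) (auto simp: g_def indicator_def)
      qed
    qed
    have em: "(\<integral>\<^sup>+x. ennreal (g x) \<partial>P) = emeasure P (S \<inter> G)" if P: "P \<in> prob_measures S" for P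
    proof -
      have "S \<inter> G \<in> sets P" using G by (auto simp: sets_prob_measures[OF P] sets_restrict_space)
      then have "emeasure P (S \<inter> G) = (\<integral>\<^sup>+x. indicator (S \<inter> G) x \<partial>P)" by simp
      also have "\<dots> = (\<integral>\<^sup>+x. ennreal (g x) \<partial>P)"
        by (intro nn_integral_cong) (auto simp: g_def space_prob_measures[OF P] indicator_def)
      finally show ?thesis ..
    qed
    have iff: "emeasure M (S \<inter> G) \<le> ennreal k \<longleftrightarrow> emeasure N (S \<inter> G) \<le> ennreal k" if "0 \<le> k" for k
      using nn_integral_lsc_le_iff[OF M lsc _ that] nn_integral_lsc_le_iff[OF N lsc _ that] eq em[OF M] em[OF N]
      by (simp add: g_def)
    show ?thesis
      using iff[of "measure M (S \<inter> G)"] iff[of "measure N (S \<inter> G)"]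
      by (simp add: M.emeasure_eq_measure N.emeasure_eq_measure)
  qed
  have meas: "(\<lambda>x. x) \<in> borel_measurable P" if "P \<in> prob_measures S" for P
  proof -
    have "(\<lambda>x. x) \<in> borel_measurable (borel_on S)"
      by (intro measurable_restrict_space1 measurable_ident_sets) simp
    then show ?thesis using measurable_cong_sets[OF sets_prob_measures[OF that] refl] by blast
  qed
  have dist: "emeasure (distr P borel (\<lambda>x. x)) X = emeasure P (S \<inter> X)" if "P \<in> prob_measures S" "X \<in> sets borel" for P X
    using emeasure_distr[OF meas[OF that(1)] that(2)] by (simp add: space_prob_measures[OF that(1)] Int_commute)
  have "distr M borel (\<lambda>x. x) = distr N borel (\<lambda>x. x)"
    by (rule measure_eqI_generator_eq[where E = "{G. open G}" and \<Omega> = UNIV and A = "\<lambda>_. UNIV"])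
       (auto simp: dist[OF M] dist[OF N] open_eq Int_stable_def sets_borel)
  then have "emeasure M (S \<inter> X) = emeasure N (S \<inter> X)" if "X \<in> sets borel" for X
    using dist[OF M that] dist[OF N that] by simp
  then show ?thesis
    using sets_prob_measures[OF M] sets_prob_measures[OF N]
    by (intro measure_eqI) (auto simp: sets_restrict_space)
qed

section \<open>The weak topology\<close>

lemma continuous_map_weak_integral:
  assumes "bounded_continuous_on S f"
  shows "continuous_map (weak_topology S) euclideanreal (\<lambda>M. \<integral>x. f x \<partial>M)"
proof -
  have "openin (weak_topology S) {M \<in> prob_measures S. (\<integral>x. f x \<partial>M) \<in> U}" if "open U" for U
    unfolding weak_topology_def
    by (rule topology_generated_by_Basis) (use assms that in \<open>auto simp: bounded_continuous_on_def\<close>)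
  then show ?thesis by (auto simp: continuous_map_def topspace_weak_topology)
qed

lemma closedin_weak_nn_integral_lsc_le:
  fixes S :: "'a::metric_space set"
  assumes lsc: "lsc_on S g" and g0: "\<And>x. x \<in> S \<Longrightarrow> 0 \<le> g x" and k: "0 \<le> k"
  shows "closedin (weak_topology S) {M \<in> prob_measures S. (\<integral>\<^sup>+x. ennreal (g x) \<partial>M) \<le> ennreal k}"
proof -
  define F where "F = {f. bounded_continuous_on S f \<and> (\<forall>x\<in>S. 0 \<le> f x \<and> f x \<le> g x)}"
  have "(\<lambda>_. 0) \<in> F" using g0 by (auto simp: F_def bounded_continuous_on_const)
  then have ne: "F \<noteq> {}" by auto
  have "closedin (weak_topology S) {M \<in> topspace (weak_topology S). (\<integral>x. f x \<partial>M) \<in> {..k}}" if "f \<in> F" for f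
    using that by (intro closedin_continuous_map_preimage[OF continuous_map_weak_integral]) (auto simp: F_def)
  then have "closedin (weak_topology S) (\<Inter>f\<in>F. {M \<in> prob_measures S. (\<integral>x. f x \<partial>M) \<le> k})"
    using ne by (intro closedin_INT) (auto simp: topspace_weak_topology)
  also have "(\<Inter>f\<in>F. {M \<in> prob_measures S. (\<integral>x. f x \<partial>M) \<le> k}) =
      {M \<in> prob_measures S. (\<integral>\<^sup>+x. ennreal (g x) \<partial>M) \<le> ennreal k}"
    using ne nn_integral_lsc_le_iff[OF _ lsc g0 k] by (fastforce simp: F_def)
  finally show ?thesis .
qed

text \<open>The set is the image, under a map continuous for the weak topology, of the compact set of positive
  normalised functionals bounded by \<open>k\<close> below \<open>g\<close>. The map sends a functional to the measure that represents it.\<close>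

theorem compactin_weak_nn_integral_le:
  fixes S :: "'a::metric_space set"
  assumes lsc: "lsc_on S g" and g0: "\<And>x. x \<in> S \<Longrightarrow> 0 \<le> g x" and k: "0 \<le> k"
    and compact_sublevel: "\<And>r. compact {x \<in> S. g x \<le> r}"
  shows "compactin (weak_topology S) {M \<in> prob_measures S. (\<integral>\<^sup>+x. ennreal (g x) \<partial>M) \<le> ennreal k}"
proof -
  define K where "K = {M \<in> prob_measures S. (\<integral>\<^sup>+x. ennreal (g x) \<partial>M) \<le> ennreal k}"
  define F where "F = {f. bounded_continuous_on S f}"
  have "\<exists>b. \<forall>x\<in>S. \<bar>f x\<bar> \<le> b" if "f \<in> F" for f
    using that bounded_continuous_onE[of S f] unfolding F_def by (metis mem_Collect_eq)
  then obtain b where b: "\<And>f x. f \<in> F \<Longrightarrow> x \<in> S \<Longrightarrow> \<bar>f x\<bar> \<le> b f" by metis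
  define box where "box = (\<Pi>\<^sub>E f\<in>UNIV. if f \<in> F then {- b f..b f} else {0})"
  have "compactin (product_topology (\<lambda>_. euclideanreal) UNIV) box"
    unfolding box_def compactin_PiE by auto
  then have box: "compact box" unfolding euclidean_product_topology by simp
  define F0 where "F0 = {f \<in> F. \<forall>x\<in>S. 0 \<le> f x}"
  define F1 where "F1 = {f \<in> F. \<forall>x\<in>S. 0 \<le> f x \<and> f x \<le> g x}"
  \<comment> \<open>Functionals are real functions on all real functions on the type, with value \<open>0\<close> outside \<open>F\<close>; every
    defining condition involves finitely many coordinates and so is closed in the product topology.\<close>
  define T where "T = box \<inter> (\<Inter>f\<in>F. \<Inter>f'\<in>F. {L. L (\<lambda>x. f x + f' x) = L f + L f'})
     \<inter> (\<Inter>f\<in>F. \<Inter>r. {L. L (\<lambda>x. r * f x) = r * L f}) \<inter> (\<Inter>f\<in>F0. {L. 0 \<le> L f})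
     \<inter> {L. L (\<lambda>_. 1) = 1} \<inter> (\<Inter>f\<in>F1. {L. L f \<le> k})"
  have compT: "compact T"
    unfolding T_def
    by (intro compact_Int_closed box closed_INT ballI closed_Collect_eq closed_Collect_le
          continuous_on_add continuous_on_mult continuous_on_const continuous_on_product_coordinates)
  define h where "h L = tight_functional.representing_measure S L" for L
  have tf: "tight_functional S L g k" if "L \<in> T" for L
    using that compact_sublevel g0 unfolding T_def F_def F0_def F1_def
    by unfold_locales auto
  have h_prob: "h L \<in> prob_measures S" if "L \<in> T" for L
    unfolding h_def using tight_functional.representing_measure_in_prob_measures[OF tf[OF that]] .
  have h_int: "(\<integral>x. f x \<partial>h L) = L f" if "L \<in> T" "f \<in> F" for L f
    unfolding h_def using tight_functional.representation[OF tf[OF that(1)]] that(2) by (simp add: F_def)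
  have cont: "continuous_map (top_of_set T) (weak_topology S) h"
    unfolding weak_topology_def
  proof (rule continuous_on_generated_topo)
    show "h ` topspace (top_of_set T) \<subseteq> \<Union> {{M \<in> prob_measures S. (\<integral>x. f x \<partial>M) \<in> U} | (f :: 'a \<Rightarrow> real) U.
        continuous_on S f \<and> bounded (f ` S) \<and> open U}"
      using h_prob topspace_weak_topology[of S]
      unfolding weak_topology_def topology_generated_by_topspace by auto
    fix V assume "V \<in> {{M \<in> prob_measures S. (\<integral>x. f x \<partial>M) \<in> U} | (f :: 'a \<Rightarrow> real) U.
        continuous_on S f \<and> bounded (f ` S) \<and> open U}"
    then obtain f U where V: "V = {M \<in> prob_measures S. (\<integral>x. f x \<partial>M) \<in> U}" "f \<in> F" "open U"
      by (auto simp: F_def bounded_continuous_on_def)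
    have "h -` V \<inter> topspace (top_of_set T) = T \<inter> (\<lambda>L. L f) -` U"
      using h_prob h_int V by auto
    moreover have "open ((\<lambda>L::('a \<Rightarrow> real) \<Rightarrow> real. L f) -` U)"
      using V(3) by (intro open_vimage continuous_on_product_coordinates)
    ultimately show "openin (top_of_set T) (h -` V \<inter> topspace (top_of_set T))"
      by (metis openin_open_Int)
  qed
  have "h ` T = K"
  proof (intro equalityI subsetI)
    fix M assume "M \<in> h ` T"
    then obtain L where L: "L \<in> T" "M = h L" by auto
    have "L f \<le> k" if "bounded_continuous_on S f" "\<forall>x\<in>S. 0 \<le> f x \<and> f x \<le> g x" for f
      using L(1) that unfolding T_def F1_def F_def by auto
    then show "M \<in> K"
      using h_prob[OF L(1)] nn_integral_lsc_le_iff[OF h_prob[OF L(1)] lsc g0 k] h_int[OF L(1)]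
      unfolding K_def L(2) F_def by auto
  next
    fix M assume "M \<in> K"
    then have M: "M \<in> prob_measures S" and Mk: "(\<integral>\<^sup>+x. ennreal (g x) \<partial>M) \<le> ennreal k" by (auto simp: K_def)
    interpret prob_space M using M by (simp add: prob_measures_def)
    have int: "integrable M f" if "f \<in> F" for f
      using bounded_continuous_on_imp_integrable[OF M] that by (simp add: F_def)
    have Fadd: "(\<lambda>x. f x + f' x) \<in> F" if "f \<in> F" "f' \<in> F" for f f'
      using that by (simp add: F_def bounded_continuous_on_add)
    have Fscale: "(\<lambda>x. r * f x) \<in> F" if "f \<in> F" for f r
      using that by (simp add: F_def bounded_continuous_on_scale)
    have F1: "(\<lambda>_. 1) \<in> F" by (simp add: F_def bounded_continuous_on_const)
    define L where "L f = (if f \<in> F then \<integral>x. f x \<partial>M else 0)" for f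
    have bound: "\<bar>\<integral>x. f x \<partial>M\<bar> \<le> b f" if "f \<in> F" for f
    proof -
      have "(\<integral>x. f x \<partial>M) \<le> b f" "- b f \<le> (\<integral>x. f x \<partial>M)"
        using b[OF that] int[OF that]
        by (auto intro!: integral_le_const integral_ge_const AE_I2 simp: space_prob_measures[OF M] abs_le_iff minus_le_iff)
      then show ?thesis by (simp add: abs_le_iff)
    qed
    have pos: "0 \<le> (\<integral>x. f x \<partial>M)" if "f \<in> F0" for f
      using that by (intro Bochner_Integration.integral_nonneg_AE AE_I2) (auto simp: F0_def space_prob_measures[OF M])
    have le: "(\<integral>x. f x \<partial>M) \<le> k" if "f \<in> F1" for f
      using nn_integral_lsc_le_iff[OF M lsc g0 k] Mk that by (auto simp: F1_def F_def)
    have "L \<in> T"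
      unfolding T_def box_def
      using bound pos le Fadd Fscale F1 int
      by (auto simp: L_def F0_def F1_def prob_space abs_le_iff minus_le_iff)
    \<comment> \<open>The measure is recovered from its functional, so every measure in the set is in the image.\<close>
    moreover have "h L = M"
      by (rule prob_measures_eqI[OF h_prob[OF \<open>L \<in> T\<close>] M]) (simp add: h_int[OF \<open>L \<in> T\<close>] F_def L_def)
    ultimately show "M \<in> h ` T" by blast
  qed
  moreover have "compactin (weak_topology S) (h ` T)"
    using compT by (intro image_compactin[OF _ cont]) (simp add: compactin_subtopology)
  ultimately show ?thesis by (simp add: K_def)
qed

section \<open>Mixtures\<close>

lemma space_mixture: "space (mixture t M N) = space M"
  by (rule sets_eq_imp_space_eq[OF sets_mixture])

lemma nn_integral_mixture:
  assumes sets: "sets N = sets M" and f: "f \<in> borel_measurable M"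
  shows "(\<integral>\<^sup>+x. f x \<partial>mixture t M N) = ennreal (1 - t) * (\<integral>\<^sup>+x. f x \<partial>M) + ennreal t * (\<integral>\<^sup>+x. f x \<partial>N)"
  using f
proof (induction rule: borel_measurable_induct)
  have space: "space N = space M" "space (mixture t M N) = space M"
    by (rule sets_eq_imp_space_eq[OF sets], rule space_mixture)
  note meas = measurable_cong_sets[OF sets refl] measurable_cong_sets[OF sets_mixture refl]
  {
    case (cong f g)
    then have "(\<integral>\<^sup>+x. f x \<partial>P) = (\<integral>\<^sup>+x. g x \<partial>P)" if "space P = space M" for P
      using that by (intro nn_integral_cong) auto
    then show ?case using cong space by metis
  next
    case (set A)
    then show ?case using emeasure_mixture[OF sets] sets by (simp add: sets_mixture)
  next
    case (mult u c)
    then show ?case by (simp add: nn_integral_cmult meas distrib_left mult.left_commute)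
  next
    case (add u v)
    then show ?case by (simp add: nn_integral_add meas distrib_left ac_simps)
  next
    case (seq U)
    have sup: "(\<integral>\<^sup>+x. (SUP i. U i) x \<partial>P) = (SUP i. \<integral>\<^sup>+x. U i x \<partial>P)" if "sets P = sets M" for P
      unfolding SUP_apply using seq(1,3) measurable_cong_sets[OF that refl]
      by (intro nn_integral_monotone_convergence_SUP) auto
    have inc: "incseq (\<lambda>i. ennreal r * (\<integral>\<^sup>+x. U i x \<partial>P))" for r P
      using seq(3) by (auto simp: incseq_def le_fun_def intro!: mult_left_mono nn_integral_mono)
    show ?case
      unfolding sup[OF refl] sup[OF sets] sup[OF sets_mixture] seq.IH SUP_mult_left_ennreal
      by (rule ennreal_SUP_add[OF inc inc])
  }
qed

lemma mixture_in_prob_measures: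
  assumes M: "M \<in> prob_measures S" and N: "N \<in> prob_measures S" and t: "0 \<le> t" "t \<le> 1"
  shows "mixture t M N \<in> prob_measures S"
proof -
  interpret M: prob_space M using M by (simp add: prob_measures_def)
  interpret N: prob_space N using N by (simp add: prob_measures_def)
  have sets: "sets N = sets M" using sets_prob_measures[OF M] sets_prob_measures[OF N] by simp
  have "emeasure (mixture t M N) (space M) = ennreal (1 - t) + ennreal t"
    using emeasure_mixture[OF sets sets.top] M.emeasure_space_1 N.emeasure_space_1
      sets_eq_imp_space_eq[OF sets] by simp
  also have "\<dots> = 1" using t by (simp flip: ennreal_plus)
  finally have "prob_space (mixture t M N)"
    by (intro prob_spaceI) (simp add: space_mixture)
  then show ?thesis using sets_prob_measures[OF M] by (simp add: prob_measures_def sets_mixture)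
qed

section \<open>A theorem of the alternative for finitely many payoffs\<close>

text \<open>A line that separates \<open>D\<close> from the open quadrant above \<open>(\<alpha>, \<alpha>)\<close> has a normal vector with nonnegative
  coordinates, since the quadrant is unbounded in both directions; \<open>s\<close> comes from normalising it.\<close>

lemma separate_from_quadrant:
  fixes D :: "(real \<times> real) set"
  assumes D: "convex D" "D \<noteq> {}" and none: "\<And>x y. (x, y) \<in> D \<Longrightarrow> x \<le> \<alpha> \<or> y \<le> \<alpha>"
  shows "\<exists>s. 0 \<le> s \<and> s \<le> 1 \<and> (\<forall>x y. (x, y) \<in> D \<longrightarrow> (1 - s) * x + s * y \<le> \<alpha>)"
proof -
  define Q where "Q = {\<alpha><..} \<times> {\<alpha><..}"
  have "convex Q" unfolding Q_def by (intro convex_Times) auto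
  moreover have "(\<alpha> + 1, \<alpha> + 1) \<in> Q" by (auto simp: Q_def)
  moreover have "D \<inter> Q = {}" using none by (force simp: Q_def)
  ultimately obtain a r where a: "a \<noteq> 0" "\<forall>z\<in>D. inner a z \<le> r" "\<forall>z\<in>Q. r \<le> inner a z"
    using separating_hyperplane_sets[OF D(1) _ D(2), of Q] by blast
  obtain a1 a2 where a12: "a = (a1, a2)" by (cases a)
  have Qle: "r \<le> a1 * (\<alpha> + e) + a2 * (\<alpha> + e')" if "0 < e" "0 < e'" for e e'
  proof -
    have "(\<alpha> + e, \<alpha> + e') \<in> Q" using that by (auto simp: Q_def)
    then show ?thesis using a(3) by (fastforce simp: a12)
  qed
  \<comment> \<open>A negative coordinate of the normal would be contradicted by moving from \<open>(\<alpha> + 1, \<alpha> + 1)\<close> by \<open>t\<close> along its axis,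
    where \<open>t\<close> is large enough to use up the slack \<open>C\<close>.\<close>
  define C where "C = a1 * (\<alpha> + 1) + a2 * (\<alpha> + 1) - r"
  have C: "0 \<le> C" using Qle[of 1 1] by (simp add: C_def)
  have a1: "0 \<le> a1"
  proof (rule ccontr)
    assume n: "\<not> 0 \<le> a1"
    define t where "t = (C + 1) / (- a1)"
    have t: "0 < t" "a1 * t = - (C + 1)" using n C by (auto simp: t_def field_simps)
    have "r \<le> a1 * (\<alpha> + (1 + t)) + a2 * (\<alpha> + 1)" using t by (intro Qle) auto
    then show False using t by (simp add: C_def distrib_left)
  qed
  have a2: "0 \<le> a2"
  proof (rule ccontr)
    assume n: "\<not> 0 \<le> a2"
    define t where "t = (C + 1) / (- a2)"
    have t: "0 < t" "a2 * t = - (C + 1)" using n C by (auto simp: t_def field_simps)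
    have "r \<le> a1 * (\<alpha> + 1) + a2 * (\<alpha> + (1 + t))" using t by (intro Qle) auto
    then show False using t by (simp add: C_def distrib_left)
  qed
  have sum: "0 < a1 + a2" using a1 a2 a(1) by (auto simp: a12 zero_prod_def)
  have "r \<le> (a1 + a2) * \<alpha>"
  proof (rule field_le_epsilon)
    fix e :: real assume "0 < e"
    then have "0 < e / (a1 + a2)" and e: "(a1 + a2) * (e / (a1 + a2)) = e" using sum by auto
    then have "r \<le> a1 * (\<alpha> + e / (a1 + a2)) + a2 * (\<alpha> + e / (a1 + a2))" by (intro Qle)
    also have "\<dots> = (a1 + a2) * \<alpha> + (a1 + a2) * (e / (a1 + a2))" by (simp only: algebra_simps)
    also have "\<dots> = (a1 + a2) * \<alpha> + e" unfolding e ..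
    finally show "r \<le> (a1 + a2) * \<alpha> + e" .
  qed
  then have D_le: "a1 * x + a2 * y \<le> (a1 + a2) * \<alpha>" if "(x, y) \<in> D" for x y
    using a(2) that by (fastforce simp: a12)
  define s where "s = a2 / (a1 + a2)"
  have s1: "1 - s = a1 / (a1 + a2)" using sum by (simp add: s_def field_simps)
  show ?thesis
  proof (intro exI[of _ s] conjI allI impI)
    show "0 \<le> s" "s \<le> 1" using a1 a2 sum by (auto simp: s_def)
    show "(1 - s) * x + s * y \<le> \<alpha>" if "(x, y) \<in> D" for x y
    proof -
      have "(1 - s) * x + s * y = (a1 * x + a2 * y) / (a1 + a2)"
        unfolding s1 unfolding s_def by (simp add: add_divide_distrib)
      also have "\<dots> \<le> \<alpha>" using D_le[OF that] sum by (simp add: pos_divide_le_eq mult.commute)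
      finally show ?thesis .
    qed
  qed
qed

text \<open>Separation of a convex set from an orthant in finitely many dimensions. The index set is not a type, so
  the statement is proved by induction: on the part of \<open>V\<close> with \<open>u i > \<alpha>\<close> the other coordinates obey the
  claim with weights \<open>q\<close>, and what remains is to separate the pairs \<open>(\<Sum>j\<in>I. q j * u j, u i)\<close> in the plane.\<close>

lemma finite_alternative:
  fixes V :: "('i \<Rightarrow> real) set"
  assumes "finite I" "I \<noteq> {}"
    and "\<And>u w t. u \<in> V \<Longrightarrow> w \<in> V \<Longrightarrow> 0 \<le> t \<Longrightarrow> t \<le> 1 \<Longrightarrow> (\<lambda>i. (1 - t) * u i + t * w i) \<in> V"
    and "\<And>u. u \<in> V \<Longrightarrow> \<exists>i\<in>I. u i \<le> \<alpha>"
  shows "\<exists>p. (\<forall>i\<in>I. 0 \<le> p i) \<and> sum p I = 1 \<and> (\<forall>u\<in>V. (\<Sum>i\<in>I. p i * u i) \<le> \<alpha>)"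
  using assms
proof (induction I arbitrary: V rule: finite_ne_induct)
  case (singleton i)
  then show ?case by (intro exI[of _ "\<lambda>_. 1"]) auto
next
  case (insert i I)
  define V' where "V' = {u \<in> V. \<alpha> < u i}"
  have "\<exists>q. (\<forall>i\<in>I. 0 \<le> q i) \<and> sum q I = 1 \<and> (\<forall>u\<in>V'. (\<Sum>i\<in>I. q i * u i) \<le> \<alpha>)"
  proof (rule insert.IH)
    fix u w and t :: real assume *: "u \<in> V'" "w \<in> V'" "0 \<le> t" "t \<le> 1"
    have "\<alpha> < (1 - t) * u i + t * w i"
      using * convex_bound_lt[of "- u i" "- \<alpha>" "- w i" "1 - t" t] by (auto simp: V'_def)
    then show "(\<lambda>i. (1 - t) * u i + t * w i) \<in> V'" using * insert.prems(1) by (auto simp: V'_def)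
  next
    fix u assume "u \<in> V'"
    then show "\<exists>i\<in>I. u i \<le> \<alpha>" using insert.prems(2)[of u] by (auto simp: V'_def)
  qed
  then obtain q where q: "\<And>i. i \<in> I \<Longrightarrow> 0 \<le> q i" "sum q I = 1" "\<And>u. u \<in> V' \<Longrightarrow> (\<Sum>i\<in>I. q i * u i) \<le> \<alpha>"
    by blast
  \<comment> \<open>The weights \<open>(1 - s) q\<close> on \<open>I\<close> together with \<open>s\<close> on \<open>i\<close>.\<close>
  have ext: "\<exists>p. (\<forall>j\<in>insert i I. 0 \<le> p j) \<and> sum p (insert i I) = 1 \<and>
      (\<forall>u. (\<Sum>j\<in>insert i I. p j * u j) = (1 - s) * (\<Sum>j\<in>I. q j * u j) + s * u i)"
    if "0 \<le> s" "s \<le> 1" for s :: real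
  proof (intro exI[of _ "\<lambda>j. if j = i then s else (1 - s) * q j"] conjI ballI allI)
    have *: "(\<Sum>j\<in>I. (if j = i then s else (1 - s) * q j) * u j) = (1 - s) * (\<Sum>j\<in>I. q j * u j)" for u
      unfolding sum_distrib_left using insert.hyps by (intro sum.cong) auto
    show "(\<Sum>j\<in>insert i I. (if j = i then s else (1 - s) * q j) * u j) = (1 - s) * (\<Sum>j\<in>I. q j * u j) + s * u i" for u
      using insert.hyps by (simp add: *)
    from this[of "\<lambda>_. 1"] show "(\<Sum>j\<in>insert i I. (if j = i then s else (1 - s) * q j)) = 1"
      using q(2) by simp
  qed (use that q(1) in auto)
  show ?case
  proof (cases "V = {}")
    case True
    then show ?thesis using ext[of 0] by auto
  next
    case False
    define D where "D = (\<lambda>u. (\<Sum>j\<in>I. q j * u j, u i)) ` V"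
    have "convex D"
      unfolding convex_alt
    proof (intro ballI allI impI)
      fix x y and t :: real assume xy: "x \<in> D" "y \<in> D" and t: "0 \<le> t \<and> t \<le> 1"
      then obtain u w where uw: "u \<in> V" "w \<in> V" "x = (\<Sum>j\<in>I. q j * u j, u i)" "y = (\<Sum>j\<in>I. q j * w j, w i)"
        by (auto simp: D_def)
      have "(\<Sum>j\<in>I. q j * ((1 - t) * u j + t * w j)) = (1 - t) * (\<Sum>j\<in>I. q j * u j) + t * (\<Sum>j\<in>I. q j * w j)"
        by (simp add: sum_distrib_left sum.distrib[symmetric] algebra_simps)
      then show "(1 - t) *\<^sub>R x + t *\<^sub>R y \<in> D"
        unfolding D_def using insert.prems(1)[OF uw(1,2), of t] t
        by (intro image_eqI[of _ _ "\<lambda>i. (1 - t) * u i + t * w i"]) (auto simp: uw)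
    qed
    moreover have "D \<noteq> {}" using False by (simp add: D_def)
    moreover have "x \<le> \<alpha> \<or> y \<le> \<alpha>" if xy: "(x, y) \<in> D" for x y
      using xy q(3) by (force simp: D_def V'_def not_le)
    ultimately have "\<exists>s. 0 \<le> s \<and> s \<le> 1 \<and> (\<forall>x y. (x, y) \<in> D \<longrightarrow> (1 - s) * x + s * y \<le> \<alpha>)"
      by (rule separate_from_quadrant)
    then obtain s where s: "0 \<le> s" "s \<le> 1" "\<And>x y. (x, y) \<in> D \<Longrightarrow> (1 - s) * x + s * y \<le> \<alpha>"
      by blast
    then have "(1 - s) * (\<Sum>j\<in>I. q j * u j) + s * u i \<le> \<alpha>" if "u \<in> V" for u
      using that by (auto simp: D_def)
    then show ?thesis using ext[OF s(1,2)] by metis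
  qed
qed

section \<open>Discrete strategies\<close>

definition discrete_measure :: "'a::topological_space set \<Rightarrow> 'a set \<Rightarrow> ('a \<Rightarrow> real) \<Rightarrow> 'a measure" where
  "discrete_measure S I p = distr (density (count_space I) (\<lambda>i. ennreal (p i))) (borel_on S) (\<lambda>x. x)"

lemma nn_integral_discrete_measure:
  assumes I: "finite I" "I \<subseteq> S" and f: "f \<in> borel_measurable (borel_on S)"
  shows "(\<integral>\<^sup>+x. f x \<partial>discrete_measure S I p) = (\<Sum>i\<in>I. ennreal (p i) * f i)"
proof -
  have "(\<lambda>x. x) \<in> measurable (density (count_space I) (\<lambda>i. ennreal (p i))) (borel_on S)"
    using I by (auto simp: space_restrict_space)
  then show ?thesis
    unfolding discrete_measure_def using I f
    by (simp add: nn_integral_distr nn_integral_density nn_integral_count_space_finite)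
qed

lemma discrete_measure_in_prob_measures:
  assumes I: "finite I" "I \<subseteq> S" and p: "\<And>i. i \<in> I \<Longrightarrow> 0 \<le> p i" "sum p I = 1"
  shows "discrete_measure S I p \<in> prob_measures S"
proof -
  have "emeasure (discrete_measure S I p) (space (discrete_measure S I p)) =
      (\<integral>\<^sup>+x. 1 \<partial>discrete_measure S I p)"
    by simp
  also have "\<dots> = (\<Sum>i\<in>I. ennreal (p i) * 1)" by (rule nn_integral_discrete_measure[OF I]) simp
  also have "\<dots> = 1" using p by (simp add: sum_ennreal)
  finally have "prob_space (discrete_measure S I p)" by (rule prob_spaceI)
  then show ?thesis by (simp add: prob_measures_def discrete_measure_def)
qed

lemma dirac_in_prob_measures: "x \<in> S \<Longrightarrow> dirac S x \<in> prob_measures S"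
  by (simp add: prob_measures_def dirac_def prob_space_return space_restrict_space)

lemma nn_integral_dirac:
  assumes "x \<in> S" "f \<in> borel_measurable (borel_on S)"
  shows "(\<integral>\<^sup>+y. f y \<partial>dirac S x) = f x"
  unfolding dirac_def using assms by (intro nn_integral_return) (auto simp: space_restrict_space)

section \<open>Payoffs against a pure strategy\<close>

text \<open>Moves all terms to the side where they are nonnegative, so that inequalities between differences can be
  integrated as inequalities between nonnegative functions. The terms \<open>ennreal r\<close> and \<open>ennreal (- r)\<close> are
  the positive and the negative part of \<open>r\<close>, because \<^const>\<open>ennreal\<close> truncates at \<open>0\<close>.\<close>

lemma ereal_le_enn2ereal_diff_iff:
  assumes "P < top \<or> N < top"
  shows "ereal r \<le> enn2ereal P - enn2ereal N \<longleftrightarrow> N < top \<and> ennreal r + N \<le> P + ennreal (- r)"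
    and "enn2ereal P - enn2ereal N \<le> ereal r \<longleftrightarrow> P < top \<and> P + ennreal (- r) \<le> ennreal r + N"
proof -
  have r: "ennreal r + ennreal n \<le> ennreal p + ennreal (- r) \<longleftrightarrow> r \<le> p - n"
    "ennreal p + ennreal (- r) \<le> ennreal r + ennreal n \<longleftrightarrow> p - n \<le> r"
    if "0 \<le> p" "0 \<le> n" for p n
    using that by (cases "0 \<le> r"; force simp: ennreal_neg simp flip: ennreal_plus)+
  show "ereal r \<le> enn2ereal P - enn2ereal N \<longleftrightarrow> N < top \<and> ennreal r + N \<le> P + ennreal (- r)"
    using assms by (cases P; cases N) (auto simp: r enn2ereal_ennreal)
  show "enn2ereal P - enn2ereal N \<le> ereal r \<longleftrightarrow> P < top \<and> P + ennreal (- r) \<le> ennreal r + N"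
    using assms by (cases P; cases N) (auto simp: r enn2ereal_ennreal)
qed

lemma (in prob_space) nn_integral_add_const:
  assumes "f \<in> borel_measurable M"
  shows "(\<integral>\<^sup>+x. f x + r \<partial>M) = (\<integral>\<^sup>+x. f x \<partial>M) + r"
    and "(\<integral>\<^sup>+x. r + f x \<partial>M) = r + (\<integral>\<^sup>+x. f x \<partial>M)"
  using assms by (simp_all add: nn_integral_add emeasure_space_1)

context zero_sum_game
begin

lemma c_measurable_pair:
  assumes "sets MA = sets (borel_on A)" "sets MB = sets (borel_on B)"
  shows "(\<lambda>z. c (fst z) (snd z)) \<in> borel_measurable (MA \<Otimes>\<^sub>M MB)"
proof -
  have sp: "space MA = A" "space MB = B"
    using assms[THEN sets_eq_imp_space_eq] by (simp_all add: space_restrict_space)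
  have "(\<lambda>x. x) \<in> borel_measurable MA" "(\<lambda>x. x) \<in> borel_measurable MB"
    unfolding measurable_cong_sets[OF assms(1) refl] measurable_cong_sets[OF assms(2) refl]
    by (intro measurable_restrict_space1 measurable_ident_sets refl)+
  then have "(\<lambda>z. (fst z, snd z)) \<in> borel_measurable (MA \<Otimes>\<^sub>M MB)"
    by (intro borel_measurable_Pair) (auto intro: measurable_compose[OF measurable_fst] measurable_compose[OF measurable_snd])
  then have "(\<lambda>z. z) \<in> measurable (MA \<Otimes>\<^sub>M MB) (borel_on (A \<times> B))"
    by (intro measurable_restrict_space2) (auto simp: space_pair_measure sp)
  from measurable_compose[OF this c_measurable] show ?thesis by (simp add: case_prod_beta)
qed

lemma parts_measurable_pair:
  assumes "sets MA = sets (borel_on A)" "sets MB = sets (borel_on B)"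
  shows "(\<lambda>(a, b). ennreal (max (c a b) 0)) \<in> borel_measurable (MA \<Otimes>\<^sub>M MB)"
    and "(\<lambda>(a, b). ennreal (- min (c a b) 0)) \<in> borel_measurable (MA \<Otimes>\<^sub>M MB)"
proof -
  note [measurable] = c_measurable_pair[OF assms]
  show "(\<lambda>(a, b). ennreal (max (c a b) 0)) \<in> borel_measurable (MA \<Otimes>\<^sub>M MB)"
    "(\<lambda>(a, b). ennreal (- min (c a b) 0)) \<in> borel_measurable (MA \<Otimes>\<^sub>M MB)"
    unfolding case_prod_beta by measurable
qed

lemma c_measurable_II:
  assumes "a \<in> A" "sets MB = sets (borel_on B)"
  shows "c a \<in> borel_measurable MB"
  using measurable_compose[OF measurable_Pair1'[of a "borel_on A" MB] c_measurable_pair[OF refl assms(2)]] assms(1)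
  by (simp add: space_restrict_space)

lemma c_measurable_I:
  assumes "b \<in> B" "sets MA = sets (borel_on A)"
  shows "(\<lambda>a. c a b) \<in> borel_measurable MA"
  using measurable_compose[OF measurable_Pair2'[of b "borel_on B" MA] c_measurable_pair[OF assms(2) refl]] assms(1)
  by (simp add: space_restrict_space)

lemma inner_integrals_measurable:
  assumes B: "MB \<in> prob_measures B" and A: "sets MA = sets (borel_on A)"
  shows "(\<lambda>a. \<integral>\<^sup>+b. ennreal (max (c a b) 0) \<partial>MB) \<in> borel_measurable MA"
    and "(\<lambda>a. \<integral>\<^sup>+b. ennreal (- min (c a b) 0) \<partial>MB) \<in> borel_measurable MA"
proof -
  interpret prob_space MB using B by (simp add: prob_measures_def)
  show "(\<lambda>a. \<integral>\<^sup>+b. ennreal (max (c a b) 0) \<partial>MB) \<in> borel_measurable MA"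
    "(\<lambda>a. \<integral>\<^sup>+b. ennreal (- min (c a b) 0) \<partial>MB) \<in> borel_measurable MA"
    using parts_measurable_pair[OF A sets_prob_measures[OF B]]
    by (auto intro!: borel_measurable_nn_integral)
qed

lemma payoff_dirac_I:
  assumes a: "a \<in> A" and B: "MB \<in> prob_measures B"
  shows "payoff c (dirac A a) MB =
    enn2ereal (\<integral>\<^sup>+b. ennreal (max (c a b) 0) \<partial>MB) - enn2ereal (\<integral>\<^sup>+b. ennreal (- min (c a b) 0) \<partial>MB)"
  unfolding payoff_def payoff_plus_def payoff_minus_def minus_ereal_def
    nn_integral_dirac[OF a inner_integrals_measurable(1)[OF B refl]]
    nn_integral_dirac[OF a inner_integrals_measurable(2)[OF B refl]] ..

lemma payoff_dirac_II:
  assumes b: "b \<in> B" and A: "MA \<in> prob_measures A"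
  shows "payoff c MA (dirac B b) =
    enn2ereal (\<integral>\<^sup>+a. ennreal (max (c a b) 0) \<partial>MA) - enn2ereal (\<integral>\<^sup>+a. ennreal (- min (c a b) 0) \<partial>MA)"
proof -
  have inner: "(\<integral>\<^sup>+b. ennreal (max (c a b) 0) \<partial>dirac B b) = ennreal (max (c a b) 0)"
    "(\<integral>\<^sup>+b. ennreal (- min (c a b) 0) \<partial>dirac B b) = ennreal (- min (c a b) 0)" if "a \<in> space MA" for a
  proof -
    have "a \<in> A" using that by (simp add: space_prob_measures[OF A])
    note [measurable] = c_measurable_II[OF this refl]
    show "(\<integral>\<^sup>+b. ennreal (max (c a b) 0) \<partial>dirac B b) = ennreal (max (c a b) 0)"
      "(\<integral>\<^sup>+b. ennreal (- min (c a b) 0) \<partial>dirac B b) = ennreal (- min (c a b) 0)"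
      by (rule nn_integral_dirac[OF b]; measurable)+
  qed
  show ?thesis
    unfolding payoff_def payoff_plus_def payoff_minus_def minus_ereal_def
    by (simp only: inner cong: nn_integral_cong)
qed

text \<open>The parameter \<open>r\<close> lets the bound be chosen above a given level as well, so that \<open>U - r\<close> is not truncated.\<close>

lemma upper_bound_II:
  assumes "a \<in> A"
  obtains U where "r \<le> U" "0 \<le> U" "\<And>b. b \<in> B \<Longrightarrow> c a b \<le> U"
proof -
  obtain U0 where "\<And>b. b \<in> B \<Longrightarrow> c a b \<le> U0"
    using c_bdd_above[OF assms] by (auto simp: bdd_above_def)
  then show ?thesis by (intro that[of "max U0 (max r 0)"]) (auto simp: le_max_iff_disj)
qed

lemma nn_integral_plus_finite_II:
  assumes a: "a \<in> A" and B: "MB \<in> prob_measures B"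
  shows "(\<integral>\<^sup>+b. ennreal (max (c a b) 0) \<partial>MB) < top"
proof -
  interpret prob_space MB using B by (simp add: prob_measures_def)
  obtain U where U: "0 \<le> U" "\<And>b. b \<in> B \<Longrightarrow> c a b \<le> U" using upper_bound_II[OF a] by blast
  have "(\<integral>\<^sup>+b. ennreal (max (c a b) 0) \<partial>MB) \<le> (\<integral>\<^sup>+b. ennreal U \<partial>MB)"
    using U by (intro nn_integral_mono ennreal_leI) (auto simp: space_prob_measures[OF B])
  also have "\<dots> < top" by (simp add: emeasure_space_1)
  finally show ?thesis .
qed

lemma nn_integral_minus_finite_I:
  assumes b: "b \<in> B" and A: "MA \<in> prob_measures A"
  shows "(\<integral>\<^sup>+a. ennreal (- min (c a b) 0) \<partial>MA) < top"
proof -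
  interpret prob_space MA using A by (simp add: prob_measures_def)
  obtain l where l: "\<And>a. a \<in> A \<Longrightarrow> l \<le> c a b"
    using c_bdd_below[OF b] by (auto simp: bdd_below_def)
  have "(\<integral>\<^sup>+a. ennreal (- min (c a b) 0) \<partial>MA) \<le> (\<integral>\<^sup>+a. ennreal (- min l 0) \<partial>MA)"
    using l by (intro nn_integral_mono ennreal_leI) (auto simp: space_prob_measures[OF A] min_le_iff_disj)
  also have "\<dots> < top" by (simp add: emeasure_space_1)
  finally show ?thesis .
qed

text \<open>Integrating \<open>c\<^sup>+ + (U - c) = U - c\<^sup>-\<close> shows that the payoff is \<open>U\<close> minus the integral of \<open>U - c a\<close>. The integral of
  \<open>c\<^sup>+\<close> is finite because \<open>c a\<close> is bounded above, so nothing is lost when the integral of \<open>c\<^sup>-\<close> is infinite.\<close>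

lemma payoff_dirac_I_ge_iff:
  assumes a: "a \<in> A" and B: "MB \<in> prob_measures B"
    and U: "r \<le> U" "0 \<le> U" "\<And>b. b \<in> B \<Longrightarrow> c a b \<le> U"
  shows "ereal r \<le> payoff c (dirac A a) MB \<longleftrightarrow> (\<integral>\<^sup>+b. ennreal (U - c a b) \<partial>MB) \<le> ennreal (U - r)"
proof -
  interpret prob_space MB using B by (simp add: prob_measures_def)
  define P where "P = (\<integral>\<^sup>+b. ennreal (max (c a b) 0) \<partial>MB)"
  define N where "N = (\<integral>\<^sup>+b. ennreal (- min (c a b) 0) \<partial>MB)"
  define G where "G = (\<integral>\<^sup>+b. ennreal (U - c a b) \<partial>MB)"
  note [measurable] = c_measurable_II[OF a sets_prob_measures[OF B]]
  have P: "P < top" unfolding P_def by (rule nn_integral_plus_finite_II[OF a B])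
  have "P + G = (\<integral>\<^sup>+b. ennreal (max (c a b) 0) + ennreal (U - c a b) \<partial>MB)"
    unfolding P_def G_def by (rule nn_integral_add[symmetric]; measurable)
  also have "\<dots> = (\<integral>\<^sup>+b. ennreal U + ennreal (- min (c a b) 0) \<partial>MB)"
  proof (rule nn_integral_cong)
    fix b assume "b \<in> space MB"
    then have "c a b \<le> U" using U(3) by (simp add: space_prob_measures[OF B])
    then have "ennreal (max (c a b) 0) + ennreal (U - c a b) = ennreal (max (c a b) 0 + (U - c a b))"
      by (intro ennreal_plus[symmetric]) auto
    also have "max (c a b) 0 + (U - c a b) = U + (- min (c a b) 0)" by linarith
    also have "ennreal (U + (- min (c a b) 0)) = ennreal U + ennreal (- min (c a b) 0)"
      using U(2) by (intro ennreal_plus) auto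
    finally show "ennreal (max (c a b) 0) + ennreal (U - c a b) = ennreal U + ennreal (- min (c a b) 0)" .
  qed
  also have "\<dots> = ennreal U + N"
    unfolding N_def by (rule nn_integral_add_const(2)) measurable
  finally have PG: "P + G = ennreal U + N" .
  have "ereal r \<le> payoff c (dirac A a) MB \<longleftrightarrow> N < top \<and> ennreal r + N \<le> P + ennreal (- r)"
    unfolding payoff_dirac_I[OF a B] P_def[symmetric] N_def[symmetric]
    using P by (intro ereal_le_enn2ereal_diff_iff) auto
  also have "\<dots> \<longleftrightarrow> G \<le> ennreal (U - r)"
  proof (cases "N < top")
    case True
    then have "P + G < top" using U(2) by (simp add: PG)
    then obtain p n g where png: "P = ennreal p" "0 \<le> p" "N = ennreal n" "0 \<le> n" "G = ennreal g" "0 \<le> g"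
      using P True by (cases P; cases N; cases G) auto
    then have "p + g = U + n" using PG U(2) by (simp flip: ennreal_plus)
    moreover have "ennreal r + N \<le> P + ennreal (- r) \<longleftrightarrow> r \<le> p - n"
      using png by (cases "0 \<le> r"; force simp: ennreal_neg simp flip: ennreal_plus)
    moreover have "G \<le> ennreal (U - r) \<longleftrightarrow> g \<le> U - r" using png U(1) by simp
    ultimately show ?thesis using True by auto
  next
    case False
    then have "P + G = top" using PG by (simp add: less_top[symmetric])
    then have "G = top" using P by (auto simp: ennreal_add_eq_top)
    then show ?thesis using False by (simp add: top_unique)
  qed
  finally show ?thesis unfolding G_def .
qed

section \<open>Weak duality\<close>

text \<open>If a real interval \<open>[s, r]\<close> lay strictly between the two sides, integrating the payoff inequalities against
  pure strategies would give \<open>r \<le> \<integral>\<integral>c\<close> and \<open>\<integral>\<integral>c \<le> s\<close>, where Fubini's theorem is applied to the parts \<open>c\<^sup>+\<close> and \<open>c\<^sup>-\<close>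
  separately. As the payoff is well-defined, one part has a finite integral, and the two inequalities make
  the other one finite too.\<close>

lemma payoff_flat_le_payoff_sharp:
  assumes MA: "MA \<in> sensible_I A B c" and MB: "MB \<in> prob_measures B"
  shows "payoff_flat A c MB \<le> payoff_sharp B c MA"
proof (rule ccontr)
  have A: "MA \<in> prob_measures A" and wd: "payoff_well_defined c MA MB" using MA MB by (auto simp: sensible_I_def)
  interpret MA: prob_space MA using A by (simp add: prob_measures_def)
  interpret MB: prob_space MB using MB by (simp add: prob_measures_def)
  interpret pair_sigma_finite MA MB ..
  assume "\<not> ?thesis"
  then obtain s where s: "payoff_sharp B c MA < ereal s" "ereal s < payoff_flat A c MB"
    using ereal_dense2 by (auto simp: not_le)
  obtain r where r: "ereal s < ereal r" "ereal r < payoff_flat A c MB" using ereal_dense2[OF s(2)] by blast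
  define P where "P = (\<integral>\<^sup>+a. (\<integral>\<^sup>+b. ennreal (max (c a b) 0) \<partial>MB) \<partial>MA)"
  define N where "N = (\<integral>\<^sup>+a. (\<integral>\<^sup>+b. ennreal (- min (c a b) 0) \<partial>MB) \<partial>MA)"
  note pm = parts_measurable_pair[OF sets_prob_measures[OF A] sets_prob_measures[OF MB]]
  have P': "P = (\<integral>\<^sup>+b. (\<integral>\<^sup>+a. ennreal (max (c a b) 0) \<partial>MA) \<partial>MB)"
    unfolding P_def by (rule Fubini'[symmetric]) (use pm in simp)
  have N': "N = (\<integral>\<^sup>+b. (\<integral>\<^sup>+a. ennreal (- min (c a b) 0) \<partial>MA) \<partial>MB)"
    unfolding N_def by (rule Fubini'[symmetric]) (use pm in simp)
  note measA = inner_integrals_measurable[OF MB sets_prob_measures[OF A]]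
  have measB: "(\<lambda>b. \<integral>\<^sup>+a. ennreal (max (c a b) 0) \<partial>MA) \<in> borel_measurable MB"
    "(\<lambda>b. \<integral>\<^sup>+a. ennreal (- min (c a b) 0) \<partial>MA) \<in> borel_measurable MB"
    using pm[THEN measurable_pair_swap] by (auto intro!: MA.borel_measurable_nn_integral simp: case_prod_beta)
  have "ennreal r + N = (\<integral>\<^sup>+a. ennreal r + (\<integral>\<^sup>+b. ennreal (- min (c a b) 0) \<partial>MB) \<partial>MA)"
    unfolding N_def by (rule MA.nn_integral_add_const(2)[OF measA(2), symmetric])
  also have "\<dots> \<le> (\<integral>\<^sup>+a. (\<integral>\<^sup>+b. ennreal (max (c a b) 0) \<partial>MB) + ennreal (- r) \<partial>MA)"
  proof (rule nn_integral_mono)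
    fix a assume "a \<in> space MA"
    then have a: "a \<in> A" by (simp add: space_prob_measures[OF A])
    have "ereal r \<le> payoff c (dirac A a) MB"
      using r(2) a unfolding payoff_flat_def by (meson INF_lower less_imp_le order_trans)
    then show "ennreal r + (\<integral>\<^sup>+b. ennreal (- min (c a b) 0) \<partial>MB) \<le> (\<integral>\<^sup>+b. ennreal (max (c a b) 0) \<partial>MB) + ennreal (- r)"
      unfolding payoff_dirac_I[OF a MB]
      using ereal_le_enn2ereal_diff_iff(1)[OF disjI1[OF nn_integral_plus_finite_II[OF a MB]]] by blast
  qed
  also have "\<dots> = P + ennreal (- r)"
    unfolding P_def by (rule MA.nn_integral_add_const(1)[OF measA(1)])
  finally have lower: "ennreal r + N \<le> P + ennreal (- r)" .
  have "P + ennreal (- s) = (\<integral>\<^sup>+b. (\<integral>\<^sup>+a. ennreal (max (c a b) 0) \<partial>MA) + ennreal (- s) \<partial>MB)"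
    unfolding P' by (rule MB.nn_integral_add_const(1)[OF measB(1), symmetric])
  also have "\<dots> \<le> (\<integral>\<^sup>+b. ennreal s + (\<integral>\<^sup>+a. ennreal (- min (c a b) 0) \<partial>MA) \<partial>MB)"
  proof (rule nn_integral_mono)
    fix b assume "b \<in> space MB"
    then have b: "b \<in> B" by (simp add: space_prob_measures[OF MB])
    have "payoff c MA (dirac B b) \<le> ereal s"
      using s(1) b unfolding payoff_sharp_def by (meson SUP_upper less_imp_le order_trans)
    then show "(\<integral>\<^sup>+a. ennreal (max (c a b) 0) \<partial>MA) + ennreal (- s) \<le> ennreal s + (\<integral>\<^sup>+a. ennreal (- min (c a b) 0) \<partial>MA)"
      unfolding payoff_dirac_II[OF b A]
      using ereal_le_enn2ereal_diff_iff(2)[OF disjI2[OF nn_integral_minus_finite_I[OF b A]]] by blast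
  qed
  also have "\<dots> = ennreal s + N"
    unfolding N' by (rule MB.nn_integral_add_const(2)[OF measB(2)])
  finally have upper: "P + ennreal (- s) \<le> ennreal s + N" .
  have fin: "P < top \<or> N < top"
    using wd unfolding payoff_well_defined_def payoff_plus_def payoff_minus_def P_def[symmetric] N_def[symmetric]
    by (cases P; cases N) auto
  have "N < top"
    using fin
  proof
    assume "P < top"
    then have "P + ennreal (- r) < top" by simp
    then have "ennreal r + N < top" by (rule le_less_trans[OF lower])
    then show ?thesis by simp
  qed
  then have "ennreal s + N < top" by simp
  then have "P + ennreal (- s) < top" by (rule le_less_trans[OF upper])
  then have "P < top" by simp
  have "ereal r \<le> enn2ereal P - enn2ereal N" "enn2ereal P - enn2ereal N \<le> ereal s"
    using ereal_le_enn2ereal_diff_iff[OF fin] lower upper \<open>N < top\<close> \<open>P < top\<close> by auto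
  then show False using r(1) by (meson leD order_trans)
qed

lemma v_flat_le_v_sharp: "v_flat A B c \<le> v_sharp A B c"
  unfolding v_flat_def v_sharp_def
  using payoff_flat_le_payoff_sharp by (intro SUP_least INF_greatest) (auto simp: sensible_II_def)

text \<open>For fixed \<open>b\<close> the payoff is bounded below in \<open>a\<close>, so its negative part has a finite integral against every
  strategy of Player I.\<close>

lemma dirac_sensible_II:
  assumes b: "b \<in> B"
  shows "dirac B b \<in> sensible_II A B c"
proof -
  have "payoff_minus c MA (dirac B b) > - \<infinity>" if A: "MA \<in> prob_measures A" for MA
  proof -
    have "(\<integral>\<^sup>+a. (\<integral>\<^sup>+b. ennreal (- min (c a b) 0) \<partial>dirac B b) \<partial>MA) = (\<integral>\<^sup>+a. ennreal (- min (c a b) 0) \<partial>MA)"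
    proof (rule nn_integral_cong)
      fix a assume "a \<in> space MA"
      then have "a \<in> A" by (simp add: space_prob_measures[OF A])
      note [measurable] = c_measurable_II[OF this refl]
      show "(\<integral>\<^sup>+b. ennreal (- min (c a b) 0) \<partial>dirac B b) = ennreal (- min (c a b) 0)"
        by (rule nn_integral_dirac[OF b]) measurable
    qed
    then show ?thesis
      using nn_integral_minus_finite_I[OF b A] unfolding payoff_minus_def
      by (simp add: less_top[symmetric] ereal_uminus_less_reorder)
  qed
  then show ?thesis
    by (simp add: sensible_II_def payoff_well_defined_def dirac_in_prob_measures[OF b])
qed

lemma payoff_dirac_dirac:
  assumes "a \<in> A" "b \<in> B"
  shows "payoff c (dirac A a) (dirac B b) = ereal (c a b)"
proof -
  note [measurable] = c_measurable_II[OF assms(1) refl]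
  have "(\<integral>\<^sup>+b. ennreal (max (c a b) 0) \<partial>dirac B b) = ennreal (max (c a b) 0)"
    "(\<integral>\<^sup>+b. ennreal (- min (c a b) 0) \<partial>dirac B b) = ennreal (- min (c a b) 0)"
    by (rule nn_integral_dirac[OF assms(2)]; measurable)+
  then show ?thesis
    unfolding payoff_dirac_I[OF assms(1) dirac_in_prob_measures[OF assms(2)]]
    by (simp add: enn2ereal_ennreal max_def min_def)
qed

lemma v_flat_greater_minf: "- \<infinity> < v_flat A B c"
proof -
  obtain b where b: "b \<in> B" using B_nonempty by blast
  obtain l where l: "\<And>a. a \<in> A \<Longrightarrow> l \<le> c a b" using c_bdd_below[OF b] by (auto simp: bdd_below_def)
  have "ereal l \<le> payoff_flat A c (dirac B b)"
    unfolding payoff_flat_def using l by (intro INF_greatest) (simp add: payoff_dirac_dirac[OF _ b])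
  also have "\<dots> \<le> v_flat A B c" unfolding v_flat_def by (rule SUP_upper[OF dirac_sensible_II[OF b]])
  finally show ?thesis by (cases "v_flat A B c") auto
qed

section \<open>Strong duality\<close>

text \<open>A finitely supported strategy of Player I is sensible: the positive part of the payoff is a finite
  combination of integrals of functions bounded above.\<close>

lemma v_sharp_le_of_weights:
  assumes I: "finite I" "I \<subseteq> A" and p: "\<And>a. a \<in> I \<Longrightarrow> 0 \<le> p a" "sum p I = 1"
    and le: "\<And>b. b \<in> B \<Longrightarrow> (\<Sum>a\<in>I. p a * c a b) \<le> r"
  shows "v_sharp A B c \<le> ereal r"
proof -
  let ?M = "discrete_measure A I p"
  have M: "?M \<in> prob_measures A" by (rule discrete_measure_in_prob_measures[OF I p])
  have "payoff_plus c ?M MB < \<infinity>" if B: "MB \<in> prob_measures B" for MB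
  proof -
    have "(\<integral>\<^sup>+a. (\<integral>\<^sup>+b. ennreal (max (c a b) 0) \<partial>MB) \<partial>?M) =
        (\<Sum>a\<in>I. ennreal (p a) * (\<integral>\<^sup>+b. ennreal (max (c a b) 0) \<partial>MB))"
      by (rule nn_integral_discrete_measure[OF I inner_integrals_measurable(1)[OF B refl]])
    also have "\<dots> < top"
      using I nn_integral_plus_finite_II[OF _ B] by (auto simp: ennreal_mult_less_top subset_iff)
    finally show ?thesis unfolding payoff_plus_def by (simp add: less_top[symmetric])
  qed
  then have "?M \<in> sensible_I A B c" using M by (auto simp: sensible_I_def payoff_well_defined_def)
  then have "v_sharp A B c \<le> payoff_sharp B c ?M" unfolding v_sharp_def by (rule INF_lower)
  also have "\<dots> \<le> ereal r"
    unfolding payoff_sharp_def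
  proof (rule SUP_least)
    fix b assume b: "b \<in> B"
    note [measurable] = c_measurable_I[OF b refl]
    have weighted: "(\<Sum>a\<in>I. ennreal (p a) * ennreal (h a)) = ennreal (\<Sum>a\<in>I. p a * h a)" if "\<And>a. 0 \<le> h a" for h
      using p(1) that by (subst sum_ennreal[symmetric]) (auto simp: ennreal_mult)
    have "(\<integral>\<^sup>+a. ennreal (max (c a b) 0) \<partial>?M) = (\<Sum>a\<in>I. ennreal (p a) * ennreal (max (c a b) 0))"
      by (rule nn_integral_discrete_measure[OF I]) measurable
    also have "\<dots> = ennreal (\<Sum>a\<in>I. p a * max (c a b) 0)" by (rule weighted) simp
    finally have plus: "(\<integral>\<^sup>+a. ennreal (max (c a b) 0) \<partial>?M) = ennreal (\<Sum>a\<in>I. p a * max (c a b) 0)" .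
    have "(\<integral>\<^sup>+a. ennreal (- min (c a b) 0) \<partial>?M) = (\<Sum>a\<in>I. ennreal (p a) * ennreal (- min (c a b) 0))"
      by (rule nn_integral_discrete_measure[OF I]) measurable
    also have "\<dots> = ennreal (\<Sum>a\<in>I. p a * (- min (c a b) 0))" by (rule weighted) simp
    finally have minus: "(\<integral>\<^sup>+a. ennreal (- min (c a b) 0) \<partial>?M) = ennreal (\<Sum>a\<in>I. p a * (- min (c a b) 0))" .
    have nonneg: "0 \<le> (\<Sum>a\<in>I. p a * max (c a b) 0)" "0 \<le> (\<Sum>a\<in>I. p a * (- min (c a b) 0))"
      by (intro sum_nonneg mult_nonneg_nonneg p(1); simp)+
    have "payoff c ?M (dirac B b) = ereal ((\<Sum>a\<in>I. p a * max (c a b) 0) - (\<Sum>a\<in>I. p a * (- min (c a b) 0)))"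
      unfolding payoff_dirac_II[OF b M] plus minus enn2ereal_ennreal[OF nonneg(1)] enn2ereal_ennreal[OF nonneg(2)]
      by simp
    also have "(\<Sum>a\<in>I. p a * max (c a b) 0) - (\<Sum>a\<in>I. p a * (- min (c a b) 0)) = (\<Sum>a\<in>I. p a * c a b)"
      unfolding sum_subtractf[symmetric] by (intro sum.cong) (auto simp: max_def min_def)
    finally show "payoff c ?M (dirac B b) \<le> ereal r" using le[OF b] by simp
  qed
  finally show ?thesis .
qed

lemma v_sharp_less_pinf: "v_sharp A B c < \<infinity>"
proof -
  obtain a where a: "a \<in> A" using A_nonempty by blast
  obtain U where U: "\<And>b. b \<in> B \<Longrightarrow> c a b \<le> U" using upper_bound_II[OF a] by blast
  have "v_sharp A B c \<le> ereal U"
    using a U by (intro v_sharp_le_of_weights[of "{a}" "\<lambda>_. 1"]) auto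
  then show ?thesis by (cases "v_sharp A B c") auto
qed

text \<open>The theorem of the alternative is applied to the vectors of finite payoffs of strategies of Player II
  against \<open>I\<close>. They are described through the integrals of \<open>U - c\<close>, for which mixtures are linear; Dirac
  measures contribute the vectors \<open>(c a b)\<^sub>a\<close>, which bound the resulting mixed strategy of Player I.\<close>

lemma ex_strategy_against_finitely_many:
  assumes I: "finite I" "I \<noteq> {}" "I \<subseteq> A" and \<alpha>: "ereal \<alpha> < v_sharp A B c"
  shows "\<exists>MB\<in>prob_measures B. \<forall>a\<in>I. ereal \<alpha> \<le> payoff c (dirac A a) MB"
proof (rule ccontr)
  assume none: "\<not> ?thesis"
  have "\<exists>U. \<alpha> \<le> U \<and> 0 \<le> U \<and> (\<forall>b\<in>B. c a b \<le> U)" if "a \<in> I" for a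
    using upper_bound_II[of a \<alpha>] that I(3) by (metis subsetD)
  then obtain U where U: "\<And>a. a \<in> I \<Longrightarrow> \<alpha> \<le> U a" "\<And>a. a \<in> I \<Longrightarrow> 0 \<le> U a" "\<And>a b. a \<in> I \<Longrightarrow> b \<in> B \<Longrightarrow> c a b \<le> U a"
    by metis
  define V where "V = {u. \<exists>MB\<in>prob_measures B. \<forall>a\<in>I. u a \<le> U a \<and>
    (\<integral>\<^sup>+b. ennreal (U a - c a b) \<partial>MB) = ennreal (U a - u a)}"
  have "\<exists>p. (\<forall>a\<in>I. 0 \<le> p a) \<and> sum p I = 1 \<and> (\<forall>u\<in>V. (\<Sum>a\<in>I. p a * u a) \<le> \<alpha>)"
  proof (rule finite_alternative[OF I(1,2)])
    fix u w and t :: real assume "u \<in> V" "w \<in> V" and t: "0 \<le> t" "t \<le> 1"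
    then obtain M N where M: "M \<in> prob_measures B" "\<And>a. a \<in> I \<Longrightarrow> u a \<le> U a"
        "\<And>a. a \<in> I \<Longrightarrow> (\<integral>\<^sup>+b. ennreal (U a - c a b) \<partial>M) = ennreal (U a - u a)"
      and N: "N \<in> prob_measures B" "\<And>a. a \<in> I \<Longrightarrow> w a \<le> U a"
        "\<And>a. a \<in> I \<Longrightarrow> (\<integral>\<^sup>+b. ennreal (U a - c a b) \<partial>N) = ennreal (U a - w a)"
      unfolding V_def by blast
    have sets: "sets N = sets M" using sets_prob_measures[OF M(1)] sets_prob_measures[OF N(1)] by simp
    have "(1 - t) * u a + t * w a \<le> U a \<and>
        (\<integral>\<^sup>+b. ennreal (U a - c a b) \<partial>mixture t M N) = ennreal (U a - ((1 - t) * u a + t * w a))" if a: "a \<in> I" for a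
    proof
      have [measurable]: "c a \<in> borel_measurable M"
        using c_measurable_II[OF _ sets_prob_measures[OF M(1)]] a I(3) by auto
      have "(\<integral>\<^sup>+b. ennreal (U a - c a b) \<partial>mixture t M N) =
          ennreal (1 - t) * ennreal (U a - u a) + ennreal t * ennreal (U a - w a)"
        by (subst nn_integral_mixture[OF sets]) (simp_all add: M(3)[OF a] N(3)[OF a])
      also have "\<dots> = ennreal ((1 - t) * (U a - u a) + t * (U a - w a))"
        using t M(2)[OF a] N(2)[OF a] by (simp add: ennreal_mult)
      also have "(1 - t) * (U a - u a) + t * (U a - w a) = U a - ((1 - t) * u a + t * w a)"
        by (simp add: algebra_simps)
      finally show "(\<integral>\<^sup>+b. ennreal (U a - c a b) \<partial>mixture t M N) = ennreal (U a - ((1 - t) * u a + t * w a))" .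
      show "(1 - t) * u a + t * w a \<le> U a"
        using convex_bound_le[OF M(2)[OF a] N(2)[OF a], of "1 - t" t] t by simp
    qed
    then show "(\<lambda>a. (1 - t) * u a + t * w a) \<in> V"
      unfolding V_def using mixture_in_prob_measures[OF M(1) N(1) t] by blast
  next
    fix u assume "u \<in> V"
    then obtain M where M: "M \<in> prob_measures B" "\<And>a. a \<in> I \<Longrightarrow> u a \<le> U a"
        "\<And>a. a \<in> I \<Longrightarrow> (\<integral>\<^sup>+b. ennreal (U a - c a b) \<partial>M) = ennreal (U a - u a)"
      unfolding V_def by blast
    obtain a where a: "a \<in> I" "\<not> ereal \<alpha> \<le> payoff c (dirac A a) M" using none M(1) by blast
    then have "a \<in> A" using I(3) by auto
    then have "\<not> ennreal (U a - u a) \<le> ennreal (U a - \<alpha>)"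
      using a payoff_dirac_I_ge_iff[OF _ M(1) U(1,2,3)] M(3) by simp
    then have "u a \<le> \<alpha>" by (meson diff_left_mono ennreal_leI linear)
    then show "\<exists>a\<in>I. u a \<le> \<alpha>" using a(1) by blast
  qed
  then obtain p where p: "\<And>a. a \<in> I \<Longrightarrow> 0 \<le> p a" "sum p I = 1" "\<And>u. u \<in> V \<Longrightarrow> (\<Sum>a\<in>I. p a * u a) \<le> \<alpha>"
    by blast
  have "(\<lambda>a. c a b) \<in> V" if b: "b \<in> B" for b
  proof -
    have "(\<integral>\<^sup>+b. ennreal (U a - c a b) \<partial>dirac B b) = ennreal (U a - c a b)" if "a \<in> I" for a
    proof -
      have "a \<in> A" using that I(3) by auto
      note [measurable] = c_measurable_II[OF this refl]
      show ?thesis by (rule nn_integral_dirac[OF b]) measurable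
    qed
    then show ?thesis unfolding V_def using dirac_in_prob_measures[OF b] U(3) b by blast
  qed
  then have "v_sharp A B c \<le> ereal \<alpha>"
    using p by (intro v_sharp_le_of_weights[OF I(1,3)]) auto
  with \<alpha> show False by simp
qed

lemma
  assumes a: "a \<in> A" and usc: "usc_on B (\<lambda>b. ereal (c a b))"
  shows closedin_payoff_level:
      "closedin (weak_topology B) {MB \<in> prob_measures B. ereal r \<le> payoff c (dirac A a) MB}"
    and compactin_payoff_level: "(\<And>s::real. compact {b \<in> B. s \<le> c a b}) \<Longrightarrow>
      compactin (weak_topology B) {MB \<in> prob_measures B. ereal r \<le> payoff c (dirac A a) MB}"
proof -
  obtain U where U: "r \<le> U" "0 \<le> U" "\<And>b. b \<in> B \<Longrightarrow> c a b \<le> U" using upper_bound_II[OF a] by blast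
  have level: "{MB \<in> prob_measures B. ereal r \<le> payoff c (dirac A a) MB} =
      {MB \<in> prob_measures B. (\<integral>\<^sup>+b. ennreal (U - c a b) \<partial>MB) \<le> ennreal (U - r)}"
    using payoff_dirac_I_ge_iff[OF a _ U] by blast
  have lsc: "lsc_on B (\<lambda>b. U - c a b)"
    unfolding lsc_on_def
  proof (intro ballI allI impI)
    fix x s assume x: "x \<in> B" and s: "s < U - c a x"
    have "Limsup (at x within B) (\<lambda>b. ereal (c a b)) \<le> ereal (c a x)" using usc x by (simp add: usc_on_def)
    also have "\<dots> < ereal (U - s)" using s by simp
    finally have "eventually (\<lambda>b. ereal (c a b) < ereal (U - s)) (at x within B)" by (rule Limsup_lessD)
    then obtain e where e: "0 < e" "\<And>y. y \<in> B \<Longrightarrow> y \<noteq> x \<Longrightarrow> dist y x < e \<Longrightarrow> c a y < U - s"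
      by (auto simp: eventually_at)
    have "s < U - c a y" if "y \<in> B" "dist y x < e" for y
      using e(2)[OF that(1) _ that(2)] s by (cases "y = x") auto
    then show "\<exists>e>0. \<forall>y\<in>B. dist y x < e \<longrightarrow> s < U - c a y" using e(1) by blast
  qed
  show "closedin (weak_topology B) {MB \<in> prob_measures B. ereal r \<le> payoff c (dirac A a) MB}"
    unfolding level using U by (intro closedin_weak_nn_integral_lsc_le[OF lsc]) auto
  assume compact: "\<And>s::real. compact {b \<in> B. s \<le> c a b}"
  have "{b \<in> B. U - c a b \<le> s} = {b \<in> B. U - s \<le> c a b}" for s by auto
  then show "compactin (weak_topology B) {MB \<in> prob_measures B. ereal r \<le> payoff c (dirac A a) MB}"
    unfolding level using U compact by (intro compactin_weak_nn_integral_le[OF lsc]) auto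
qed

lemma mixture_payoff_ge:
  assumes a: "a \<in> A" and M: "M \<in> prob_measures B" and N: "N \<in> prob_measures B" and t: "0 \<le> t" "t \<le> 1"
    and ge: "ereal r \<le> payoff c (dirac A a) M" "ereal r \<le> payoff c (dirac A a) N"
  shows "ereal r \<le> payoff c (dirac A a) (mixture t M N)"
proof -
  obtain U where U: "r \<le> U" "0 \<le> U" "\<And>b. b \<in> B \<Longrightarrow> c a b \<le> U" using upper_bound_II[OF a] by blast
  have sets: "sets N = sets M" using sets_prob_measures[OF M] sets_prob_measures[OF N] by simp
  have [measurable]: "c a \<in> borel_measurable M" by (rule c_measurable_II[OF a sets_prob_measures[OF M]])
  have "(\<integral>\<^sup>+b. ennreal (U - c a b) \<partial>mixture t M N) =
      ennreal (1 - t) * (\<integral>\<^sup>+b. ennreal (U - c a b) \<partial>M) + ennreal t * (\<integral>\<^sup>+b. ennreal (U - c a b) \<partial>N)"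
    by (rule nn_integral_mixture[OF sets]) measurable
  also have "\<dots> \<le> ennreal (1 - t) * ennreal (U - r) + ennreal t * ennreal (U - r)"
    using ge payoff_dirac_I_ge_iff[OF a M U] payoff_dirac_I_ge_iff[OF a N U]
    by (intro add_mono mult_left_mono) auto
  also have "\<dots> = ennreal ((1 - t) * (U - r) + t * (U - r))" using t U(1) by (simp add: ennreal_mult)
  also have "(1 - t) * (U - r) + t * (U - r) = U - r" by (simp add: algebra_simps)
  finally show ?thesis using payoff_dirac_I_ge_iff[OF a mixture_in_prob_measures[OF M N t] U] by simp
qed

lemma flat_level_set_eq:
  "flat_level_set A B c r = (\<Inter>a\<in>A. {MB \<in> prob_measures B. r \<le> payoff c (dirac A a) MB})"
  using A_nonempty by (auto simp: flat_level_set_def payoff_flat_def le_INF_iff)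

lemma convex_flat_level_set: "convex_measures (flat_level_set A B c (ereal r))"
  unfolding convex_measures_def flat_level_set_eq
  by (auto intro!: mixture_payoff_ge intro: mixture_in_prob_measures)

text \<open>The levels \<open>r < v\<close> are strict because a strategy against finitely many actions exists only below \<open>v\<^sup>\<sharp>\<close>; the
  level \<open>v\<close> itself is reached by intersecting over all \<open>r < v\<close>. All members of the family are closed and
  \<open>K (a0, v - 1)\<close> is compact, so the finite intersection property suffices.\<close>

lemma
  assumes usc: "\<And>a. a \<in> A \<Longrightarrow> usc_on B (\<lambda>b. ereal (c a b))"
    and a0: "a0 \<in> A" and compact: "\<And>s::real. compact {b \<in> B. s \<le> c a0 b}"
    and v: "v_sharp A B c = ereal v"
  shows flat_level_set_v_sharp_nonempty: "flat_level_set A B c (ereal v) \<noteq> {}"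
    and compactin_flat_level_set_v_sharp: "compactin (weak_topology B) (flat_level_set A B c (ereal v))"
proof -
  define K where "K z = {MB \<in> prob_measures B. ereal (snd z) \<le> payoff c (dirac A (fst z)) MB}" for z
  have closed: "closedin (weak_topology B) (K (a, r))" if "a \<in> A" for a r
    unfolding K_def using closedin_payoff_level[OF that usc[OF that], of r] by simp
  have comp: "compactin (weak_topology B) (K (a0, r))" for r
    unfolding K_def using compactin_payoff_level[OF a0 usc[OF a0] compact, of r] by simp
  have eq: "flat_level_set A B c (ereal v) = (\<Inter>a\<in>A. K (a, v))" by (simp add: flat_level_set_eq K_def)
  have "closedin (weak_topology B) (\<Inter>a\<in>A. K (a, v))" using closed A_nonempty by (intro closedin_INT) auto
  then have "compactin (weak_topology B) ((\<Inter>a\<in>A. K (a, v)) \<inter> K (a0, v))" by (rule closed_Int_compactin[OF _ comp])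
  moreover have "(\<Inter>a\<in>A. K (a, v)) \<inter> K (a0, v) = (\<Inter>a\<in>A. K (a, v))" using a0 by auto
  ultimately show "compactin (weak_topology B) (flat_level_set A B c (ereal v))" unfolding eq by simp
  have "K (a0, v - 1) \<inter> \<Inter> (K ` (A \<times> {..<v})) \<noteq> {}"
  proof (rule comp[of "v - 1", unfolded compactin_fip, THEN conjunct2, rule_format, OF conjI])
    show "\<forall>C\<in>K ` (A \<times> {..<v}). closedin (weak_topology B) C" using closed by auto
    show "\<forall>\<F>. finite \<F> \<and> \<F> \<subseteq> K ` (A \<times> {..<v}) \<longrightarrow> K (a0, v - 1) \<inter> \<Inter> \<F> \<noteq> {}"
    proof (intro allI impI)
      fix \<F> assume \<F>: "finite \<F> \<and> \<F> \<subseteq> K ` (A \<times> {..<v})"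
      then obtain J where J: "J \<subseteq> A \<times> {..<v}" "finite J" "\<F> = K ` J" using finite_subset_image by metis
      define \<alpha> where "\<alpha> = Max (insert (v - 1) (snd ` J))"
      have "\<alpha> < v" unfolding \<alpha>_def using J by (subst Max_less_iff) auto
      then have "ereal \<alpha> < v_sharp A B c" by (simp add: v)
      moreover have "insert a0 (fst ` J) \<subseteq> A" "finite (insert a0 (fst ` J))" using J a0 by auto
      ultimately obtain MB where MB: "MB \<in> prob_measures B" "\<And>a. a \<in> insert a0 (fst ` J) \<Longrightarrow> ereal \<alpha> \<le> payoff c (dirac A a) MB"
        using ex_strategy_against_finitely_many[of "insert a0 (fst ` J)" \<alpha>] by blast
      have "MB \<in> K (a, r)" if "(a, r) \<in> insert (a0, v - 1) J" for a r
      proof -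
        have "r \<le> \<alpha>" unfolding \<alpha>_def using J(2) that by (intro Max_ge) (auto intro: rev_image_eqI)
        moreover have "a \<in> insert a0 (fst ` J)" using that by (auto intro: rev_image_eqI)
        ultimately show ?thesis
          using MB(1) MB(2)[of a] unfolding K_def by (auto intro: order_trans[of "ereal r" "ereal \<alpha>"])
      qed
      then have "MB \<in> K (a0, v - 1) \<inter> \<Inter> \<F>" unfolding J(3) by force
      then show "K (a0, v - 1) \<inter> \<Inter> \<F> \<noteq> {}" by blast
    qed
  qed
  then obtain MB where MB: "MB \<in> prob_measures B" "\<And>a r. a \<in> A \<Longrightarrow> r < v \<Longrightarrow> ereal r \<le> payoff c (dirac A a) MB"
    unfolding K_def by fastforce
  have "ereal v \<le> payoff c (dirac A a) MB" if "a \<in> A" for a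
  proof (rule dense_le)
    fix z assume z: "z < ereal v"
    then obtain r where "z < ereal r" "ereal r < ereal v" using ereal_dense2 by blast
    then show "z \<le> payoff c (dirac A a) MB" using MB(2)[OF that, of r] by (auto intro: order_trans less_imp_le)
  qed
  then show "flat_level_set A B c (ereal v) \<noteq> {}" using MB(1) unfolding flat_level_set_eq by auto
qed

end

section \<open>Value and solutions\<close>

theorem corollary3p6:
  fixes A :: "'a::polish_space set"
    and B :: "'b::polish_space set"
    and c :: "'a \<Rightarrow> 'b \<Rightarrow> real"
  assumes game: "zero_sum_game A B c"
    and b1: "\<And>a. a \<in> A \<Longrightarrow> usc_on B (\<lambda>b. ereal (c a b))"
    and b2: "\<exists>a\<^sub>0\<in>A. sup_compact_on B (\<lambda>b. ereal (c a\<^sub>0 b))"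
    and unsensible_le: "\<And>\<pi>B. \<pi>B \<in> unsensible_II A B c \<Longrightarrow> payoff_flat A c \<pi>B \<le> v_flat A B c"
  shows "\<exists>v. is_game_value A B c v \<and>
    ((\<forall>\<pi>B\<in>unsensible_II A B c. payoff_flat A c \<pi>B < v_flat A B c) \<longrightarrow>
      flat_level_set A B c v \<subseteq> sensible_II A B c \<and>
      flat_level_set A B c v = solutions_II A B c \<and>
      flat_level_set A B c v \<noteq> {} \<and>
      convex_measures (flat_level_set A B c v) \<and>
      compactin (weak_topology B) (flat_level_set A B c v))"
proof -
  interpret zero_sum_game A B c by (rule game)
  obtain a0 where a0: "a0 \<in> A" "\<And>s::real. compact {b \<in> B. s \<le> c a0 b}"
    using b2 by (auto simp: sup_compact_on_def)
  obtain v where v: "v_sharp A B c = ereal v"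
    using v_flat_greater_minf v_flat_le_v_sharp v_sharp_less_pinf by (cases "v_sharp A B c") auto
  note level = flat_level_set_v_sharp_nonempty[OF b1 a0 v] compactin_flat_level_set_v_sharp[OF b1 a0 v]
  have flat_le: "payoff_flat A c M \<le> v_flat A B c" if "M \<in> prob_measures B" for M
  proof (cases "M \<in> sensible_II A B c")
    case True
    then show ?thesis unfolding v_flat_def by (rule SUP_upper)
  next
    case False
    then show ?thesis using that by (intro unsensible_le) (simp add: unsensible_II_def)
  qed
  obtain M where "M \<in> prob_measures B" "ereal v \<le> payoff_flat A c M"
    using level(1) by (auto simp: flat_level_set_def)
  then have "ereal v \<le> v_flat A B c" using flat_le order_trans by blast
  then have v_flat: "v_flat A B c = ereal v" using v_flat_le_v_sharp v by (intro antisym) auto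
  show ?thesis
  proof (intro exI[of _ "ereal v"] conjI impI)
    show "is_game_value A B c (ereal v)" by (simp add: is_game_value_def v v_flat)
    assume strict: "\<forall>\<pi>B\<in>unsensible_II A B c. payoff_flat A c \<pi>B < v_flat A B c"
    then show sub: "flat_level_set A B c (ereal v) \<subseteq> sensible_II A B c"
      unfolding v_flat flat_level_set_def unsensible_II_def by (blast dest: leD)
    have "sensible_II A B c \<subseteq> prob_measures B" by (auto simp: sensible_II_def)
    then show "flat_level_set A B c (ereal v) = solutions_II A B c"
      using sub flat_le by (auto simp: flat_level_set_def solutions_II_def v_flat intro!: antisym)
  qed (use level convex_flat_level_set in auto)
qed

end
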